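(* Each $\sim$ congruence class of $*$-permutations in $S_n'$ is an interval in the weak Bruhat order on $S_n'$, and is a union of several Tamari congruence classes of $S_n$ (after the identification of $S_n'$ and $S_n$ by removing $*$'s). For each class, the top bound of the interval is a $132$-avoiding $*$-permutation and the bottom bound is a $231$-avoiding $*$-permutation.
   Context: $*$-permutations. A $*$-permutation of length $n$ is a map $\sigma:\mathbb N^+\to\{1,\dots,n\}\cup\{*\}$, $\mathbb N^+=\{1,2,\dots\}$, such that each of $1,\dots,n$ has exactly one preimage; it is viewed as an infinite sequence of terms. The symbols $1,\dots,n$ are called concrete, and $*$ is considered larger than every concrete symbol. The set $S_n'$. Fix a set of $n$ positions in $\mathbb N^+$; $S_n'$ is the set of the $n!$ $*$-permutations of length $n$ whose concrete symbols occupy exactly these positions. Let $z$ be the largest of these positions. Weak Bruhat order. For $\sigma\in S_n'$, $(i\ i+1)\circ\sigma$ is obtained from $\sigma$ by exchanging the positions of $i$ and $i+1$. The (left) weak Bruhat order $\preceq$ on $S_n'$ is the reflexive transitive closure of the relations "$(i\ i+1)\circ\sigma$ covers $\sigma$ whenever $i$ is to the left of $i+1$ in $\sigma$". Removing the $*$'s identifies $S_n'$ with the symmetric group $S_n$ under its usual left weak Bruhat order. Pattern avoidance. $\sigma\in S_n'$ is $132$-avoiding if there are no indices $1\le a<b<c\le z$ with $\sigma(a)<\sigma(c)<\sigma(b)$, and $231$-avoiding if there are no indices $1\le a<b<c\le z$ with $\sigma(c)<\sigma(a)<\sigma(b)$ (in both cases $\sigma(b)$ may be $*$, while the other two symbols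 must be concrete). Linearized forests and $\sim$. A labeled binary rooted forest is a left-to-right sequence of finite planar rooted binary trees (every interior vertex has a left and a right child), with all but finitely many trivial (a single vertex), and with the leaves of the whole forest labeled $0,1,2,\dots$ from left to right. A linearized forest with $n$ interior vertices is such a forest with a bijective labeling of its interior vertices by $1,\dots,n$ that decreases along every path from a root to a leaf. For $i\ge1$, an interior vertex covers the gap $(i-1,i)$ if it is the last common vertex on the paths from the root to the leaves $i-1$ and $i$; the gap is uncovered if these leaves lie in different trees. To a linearized forest $f$ assign the $*$-permutation $\pi(f)$ with $\pi(f)(i)$ the label of the vertex covering the gap $(i-1,i)$, or $*$ if the gap is uncovered. This is a bijection from linearized forests to $*$-permutations; let $\tau$ be its inverse. For $*$-permutations, $\rho\sim\sigma$ means that $\tau(\rho)$ and $\tau(\sigma)$ become equal after the labels on interior vertices are deleted. The Tamari congruence classes of $S_n$ are the $\sim$ classes on $S_n$, where $\sigma\in S_n$ is viewed as the $*$-permutation $\sigma(1)\cdots\sigma(n)***\cdots$. *)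

theory Defs
  imports
    "HOL-Library.Extended_Nat"
    "HOL-Library.Tree"
    "HOL-Library.Sublist"
    "HOL-Combinatorics.Permutations"
begin

text \<open>
  The star is \<^term>\<open>\<infinity> :: enat\<close>, so it is larger than every concrete symbol in the library's
  order on \<^typ>\<open>enat\<close>.  Sequences are indexed by the positive integers; the unused
  value at index 0 is fixed to be \<^term>\<open>\<infinity> :: enat\<close>, so that equality of functions is
  equality of the sequences.
\<close>

type_synonym star_seq = "nat \<Rightarrow> enat"

definition star_perm :: "nat \<Rightarrow> star_seq \<Rightarrow> bool" where
  "star_perm n \<sigma> \<longleftrightarrow>
     \<sigma> 0 = \<infinity> \<and>
     (\<forall>i\<ge>1. \<sigma> i \<in> insert \<infinity> (enat ` {1..n})) \<and>
     (\<forall>k\<in>{1..n}. \<exists>!i. 1 \<le> i \<and> \<sigma> i = enat k)"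

definition concrete_positions :: "star_seq \<Rightarrow> nat set" where
  "concrete_positions \<sigma> = {i. 1 \<le> i \<and> \<sigma> i \<noteq> \<infinity>}"

definition star_perms_on :: "nat \<Rightarrow> nat set \<Rightarrow> star_seq set" where
  "star_perms_on n P = {\<sigma>. star_perm n \<sigma> \<and> concrete_positions \<sigma> = P}"


definition weak_cover :: "nat \<Rightarrow> nat set \<Rightarrow> star_seq \<Rightarrow> star_seq \<Rightarrow> bool" where
  "weak_cover n P \<sigma> \<rho> \<longleftrightarrow>
     \<sigma> \<in> star_perms_on n P \<and>
     (\<exists>i a b. 1 \<le> i \<and> i < n \<and> 1 \<le> a \<and> a < b \<and> \<sigma> a = enat i \<and> \<sigma> b = enat (i + 1) \<and>
        \<rho> = transpose (enat i) (enat (i + 1)) \<circ> \<sigma>)"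

definition weak_le :: "nat \<Rightarrow> nat set \<Rightarrow> star_seq \<Rightarrow> star_seq \<Rightarrow> bool" where
  "weak_le n P = (weak_cover n P)\<^sup>*\<^sup>*"

definition weak_interval :: "nat \<Rightarrow> nat set \<Rightarrow> star_seq \<Rightarrow> star_seq \<Rightarrow> star_seq set" where
  "weak_interval n P lo hi = {\<rho> \<in> star_perms_on n P. weak_le n P lo \<rho> \<and> weak_le n P \<rho> hi}"


text \<open>
  In both patterns the strict inequalities force the two smaller symbols to be
  concrete, while the largest one, at position \<open>b\<close>, may be the star.
\<close>

definition avoids_132 :: "nat \<Rightarrow> star_seq \<Rightarrow> bool" where
  "avoids_132 z \<sigma> \<longleftrightarrow>
     \<not> (\<exists>a b c. 1 \<le> a \<and> a < b \<and> b < c \<and> c \<le> z \<and> \<sigma> a < \<sigma> c \<and> \<sigma> c < \<sigma> b)"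

definition avoids_231 :: "nat \<Rightarrow> star_seq \<Rightarrow> bool" where
  "avoids_231 z \<sigma> \<longleftrightarrow>
     \<not> (\<exists>a b c. 1 \<le> a \<and> a < b \<and> b < c \<and> c \<le> z \<and> \<sigma> c < \<sigma> a \<and> \<sigma> a < \<sigma> b)"


text \<open>
  A vertex of a tree is addressed by the path leading to it from the root
  (\<^term>\<open>False\<close>: left child, \<^term>\<open>True\<close>: right child); \<^term>\<open>Leaf\<close> is the trivial tree.
  The last common vertex of two paths is then their longest common prefix.
\<close>

primrec leaf_addrs :: "'a tree \<Rightarrow> bool list list" where
  "leaf_addrs \<langle>\<rangle> = [[]]"
| "leaf_addrs \<langle>l, x, r\<rangle> = map (Cons False) (leaf_addrs l) @ map (Cons True) (leaf_addrs r)"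

fun label_at :: "'a tree \<Rightarrow> bool list \<Rightarrow> 'a option" where
  "label_at \<langle>\<rangle> p = None"
| "label_at \<langle>l, x, r\<rangle> [] = Some x"
| "label_at \<langle>l, x, r\<rangle> (b # p) = label_at (if b then r else l) p"

primrec decreasing_tree :: "nat tree \<Rightarrow> bool" where
  "decreasing_tree \<langle>\<rangle> \<longleftrightarrow> True"
| "decreasing_tree \<langle>l, x, r\<rangle> \<longleftrightarrow>
     (\<forall>y \<in> set_tree l \<union> set_tree r. y < x) \<and> decreasing_tree l \<and> decreasing_tree r"

type_synonym 'a forest = "nat \<Rightarrow> 'a tree"

text \<open>
  The last three conjuncts say that the labelling of the interior vertices of the whole
  forest is a bijection onto \<open>{1..n}\<close>.
\<close>

definition linearized_forest :: "nat \<Rightarrow> nat forest \<Rightarrow> bool" where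
  "linearized_forest n f \<longleftrightarrow>
     finite {j. f j \<noteq> \<langle>\<rangle>} \<and>
     (\<forall>j. decreasing_tree (f j)) \<and>
     (\<forall>j. distinct (inorder (f j))) \<and>
     (\<forall>j k. j \<noteq> k \<longrightarrow> set_tree (f j) \<inter> set_tree (f k) = {}) \<and>
     (\<Union>j. set_tree (f j)) = {1..n}"

text \<open>
  Leaf number \<open>i\<close> of the forest (counted from 0, from left to right) is the leaf with
  address \<open>p\<close> of the tree \<open>f j\<close>; \<^term>\<open>size1 t\<close> is the number of leaves of \<open>t\<close>.
\<close>

definition forest_leaf :: "'a forest \<Rightarrow> nat \<Rightarrow> nat \<Rightarrow> bool list \<Rightarrow> bool" where
  "forest_leaf f i j p \<longleftrightarrow>
     (\<exists>m < size1 (f j). i = (\<Sum>k<j. size1 (f k)) + m \<and> p = leaf_addrs (f j) ! m)"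

text \<open>The vertex with address \<open>v\<close> of the tree \<open>f j\<close> covers the gap \<open>(i - 1, i)\<close>.\<close>

definition covers_gap :: "'a forest \<Rightarrow> nat \<Rightarrow> nat \<Rightarrow> bool list \<Rightarrow> bool" where
  "covers_gap f i j v \<longleftrightarrow>
     1 \<le> i \<and> (\<exists>p q. forest_leaf f (i - 1) j p \<and> forest_leaf f i j q \<and> v = longest_common_prefix p q)"

definition forest_perm :: "nat forest \<Rightarrow> star_seq" where
  "forest_perm f i =
     (if \<exists>j v. covers_gap f i j v
      then enat (THE x. \<exists>j v. covers_gap f i j v \<and> label_at (f j) v = Some x)
      else \<infinity>)"

definition perm_forest :: "star_seq \<Rightarrow> nat forest" where
  "perm_forest = the_inv_into {f. \<exists>n. linearized_forest n f} forest_perm"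

definition delete_labels :: "'a forest \<Rightarrow> unit forest" where
  "delete_labels f = (\<lambda>j. map_tree (\<lambda>_. ()) (f j))"

definition forest_equiv :: "star_seq \<Rightarrow> star_seq \<Rightarrow> bool" (infix "\<sim>" 50) where
  "\<rho> \<sim> \<sigma> \<longleftrightarrow> delete_labels (perm_forest \<rho>) = delete_labels (perm_forest \<sigma>)"

definition congruence_classes :: "nat \<Rightarrow> nat set \<Rightarrow> star_seq set set" where
  "congruence_classes n P =
     star_perms_on n P // {(\<rho>, \<sigma>). \<rho> \<in> star_perms_on n P \<and> \<sigma> \<in> star_perms_on n P \<and> \<rho> \<sim> \<sigma>}"


definition append_stars :: "nat \<Rightarrow> (nat \<Rightarrow> nat) \<Rightarrow> star_seq" where
  "append_stars n p i = (if i \<in> {1..n} then enat (p i) else \<infinity>)"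

definition tamari_classes :: "nat \<Rightarrow> (nat \<Rightarrow> nat) set set" where
  "tamari_classes n =
     {p. p permutes {1..n}} //
       {(p, q). p permutes {1..n} \<and> q permutes {1..n} \<and> append_stars n p \<sim> append_stars n q}"

text \<open>
  The \<open>k\<close>-th remaining symbol, \<open>k \<ge> 1\<close>, is the one at the \<open>k\<close>-th smallest concrete position;
  outside \<open>{1..n}\<close> the result is the identity, as \<^term>\<open>p permutes {1..n}\<close> requires.
\<close>

definition remove_stars :: "star_seq \<Rightarrow> nat \<Rightarrow> nat" where
  "remove_stars \<sigma> k =
     (if k \<in> {1..card (concrete_positions \<sigma>)}
      then the_enat (\<sigma> (sorted_list_of_set (concrete_positions \<sigma>) ! (k - 1)))
      else k)"

end

theory Submission
  imports Defs
begin

text \<open>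
  A linearized forest is the forest of decreasing binary trees of the maximal star-free
  runs of its sequence: the root of a tree carries the largest symbol of the run, and the
  symbols to the left and to the right of it form the two subtrees.  Call position \<open>k\<close> an
  \<^emph>\<open>ancestor\<close> of position \<open>i\<close> if all symbols at the positions from \<open>i\<close> to \<open>k\<close> are concrete and
  the one at \<open>k\<close> is the largest of them.  The unlabelled forest determines and is determined
  by this relation, so two sequences are congruent exactly if they have the same ancestors
  (\<open>forest_equiv_iff\<close>).

  The weak order is inclusion of inversion sets (\<open>weak_le_iff_inversions\<close>).  For a pair of
  positions \<open>a < b\<close>, all members of a class agree if one of the two is an ancestor of the
  other: there is an inversion if it is \<open>a\<close>, and none if it is \<open>b\<close>.
  The remaining pairs are separated by a position \<open>d\<close> with a larger symbol or a star, and
  exchanging two consecutive symbols on opposite sides of such a \<open>d\<close> does not leave the class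
  (\<open>ancestor_exchange\<close>).  A non-inverted pair of the remaining kind is a 132 pattern with \<open>d\<close>
  in the middle, an inverted one is a 231 pattern.
  In the presence of a pattern there is also one of the same kind, around the same \<open>d\<close>, whose
  outer symbols are consecutive (\<open>ex_consecutive_pattern\<close>).  Hence a member with the most
  inversions avoids 132 and one with the fewest avoids 231.  The first has
  every inversion that the ancestors permit, the second only those that they force.
  So the class is contained in the interval between
  them; conversely, the order of every ancestor pair is constant on that interval, and this
  suffices to fix the ancestor relation (\<open>ancestor_eq_if_subset\<close>).

  Finally, the positions of the stars only restrict which ancestor pairs survive: the ancestors
  in a sequence are those of the permutation obtained by removing the stars, with the
  pairs that have a star in between left out.  So removing the stars turns a class into a union of
  Tamari classes.
\<close>

section \<open>The gaps of a forest and its covering vertices\<close>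

lemma length_leaf_addrs: "length (leaf_addrs t) = size1 t"
  by (induction t) auto

text \<open>
  The vertices in symmetric order are in bijection with the gaps between neighbouring leaves.
  The gap between the two subtrees is covered by the root, whose two addresses part at once;
  every other gap lies inside one subtree.
\<close>

lemma label_at_last_common_vertex:
  "m < size t \<Longrightarrow>
     label_at t (longest_common_prefix (leaf_addrs t ! m) (leaf_addrs t ! Suc m)) = Some (inorder t ! m)"
proof (induction t arbitrary: m)
  case Leaf
  then show ?case by simp
next
  case (Node l x r)
  have len: "length (leaf_addrs l) = Suc (size l)" "length (leaf_addrs r) = Suc (size r)"
    by (simp_all add: length_leaf_addrs size1_size)
  consider "m < size l" | "m = size l" | k where "m = Suc (size l + k)" "k < size r"
    using Node.prems less_iff_Suc_add[of "size l" m] by fastforce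
  then show ?case
  proof cases
    case 1
    then show ?thesis using Node.IH(1)[of m] len by (simp add: nth_append)
  next
    case 2
    then show ?thesis using len by (simp add: nth_append)
  next
    case 3
    then show ?thesis using Node.IH(2)[of k] len by (simp add: nth_append)
  qed
qed

text \<open>
  The number of the first leaf of the tree \<open>f j\<close>.  Since the gap before this leaf is uncovered,
  it is also the position of a star.
\<close>

definition offset :: "'a forest \<Rightarrow> nat \<Rightarrow> nat" where
  "offset f j = (\<Sum>k<j. size1 (f k))"

lemma offset_Suc: "offset f (Suc j) = Suc (offset f j + size (f j))"
  by (simp add: offset_def size1_size)

lemma strict_mono_offset: "strict_mono (offset f)"
  by (simp add: strict_mono_Suc_iff offset_Suc)

lemma offset_decomposition:
  obtains j m where "i = offset f j + m" "m < size1 (f j)"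
proof -
  have "\<exists>j m. i = offset f j + m \<and> m < size1 (f j)"
  proof (induction i)
    case 0
    have "0 = offset f 0 + 0" "0 < size1 (f 0)" by (simp_all add: offset_def size1_size)
    then show ?case by blast
  next
    case (Suc i)
    then obtain j m where jm: "i = offset f j + m" "m < size1 (f j)" by blast
    show ?case
    proof (cases "Suc m < size1 (f j)")
      case True
      then show ?thesis using jm by (metis add_Suc_right)
    next
      case False
      then have "Suc i = offset f (Suc j) + 0" using jm by (simp add: offset_Suc size1_size)
      moreover have "0 < size1 (f (Suc j))" by (simp add: size1_size)
      ultimately show ?thesis by blast
    qed
  qed
  then show thesis using that by blast
qed

lemma offset_decomposition_unique:
  assumes "offset f j + m = offset f j' + m'" "m < size1 (f j)" "m' < size1 (f j')"
  shows "j = j'" "m = m'"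
proof -
  have le: "\<not> a < b" if "offset f a + x = offset f b + y" "x < size1 (f a)" for a b x y
  proof
    assume "a < b"
    then have "offset f (Suc a) \<le> offset f b"
      using strict_mono_less_eq[OF strict_mono_offset, of f "Suc a" b] by simp
    then show False using that by (simp add: offset_Suc size1_size)
  qed
  show "j = j'" using le[of j m j' m'] le[of j' m' j m] assms by (metis linorder_neqE_nat)
  then show "m = m'" using assms(1) by simp
qed

lemma forest_leaf_iff:
  assumes "m < size1 (f j)"
  shows "forest_leaf f (offset f j + m) j' p \<longleftrightarrow> j' = j \<and> p = leaf_addrs (f j) ! m"
  unfolding forest_leaf_def offset_def[symmetric]
  using offset_decomposition_unique[of f j m] assms by blast

lemma forest_perm_offset: "forest_perm f (offset f j) = \<infinity>"
proof -
  have "\<not> covers_gap f (offset f j) k v" for k v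
  proof
    assume "covers_gap f (offset f j) k v"
    then obtain p q where pos: "1 \<le> offset f j" and lf: "forest_leaf f (offset f j - 1) k p"
        "forest_leaf f (offset f j) k q"
      by (auto simp: covers_gap_def)
    have "k = j" using forest_leaf_iff[of 0 f j k q] lf(2) by (simp add: size1_size)
    then show False using lf(1) pos by (auto simp: forest_leaf_def offset_def)
  qed
  then show ?thesis by (simp add: forest_perm_def)
qed

text \<open>
  Together with \<open>forest_perm_offset\<close> this reads the sequence of a forest as the concatenation of
  the inorder traversals of its trees, each preceded by one star.
\<close>

lemma forest_perm_inner:
  assumes "m < size (f j)"
  shows "forest_perm f (Suc (offset f j + m)) = enat (inorder (f j) ! m)"
proof -
  let ?i = "Suc (offset f j + m)"
  let ?v = "longest_common_prefix (leaf_addrs (f j) ! m) (leaf_addrs (f j) ! Suc m)"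
  have "forest_leaf f (?i - 1) k p \<longleftrightarrow> k = j \<and> p = leaf_addrs (f j) ! m"
       "forest_leaf f ?i k p \<longleftrightarrow> k = j \<and> p = leaf_addrs (f j) ! Suc m" for k p
    using forest_leaf_iff[of m f j k p] forest_leaf_iff[of "Suc m" f j k p] assms
    by (simp_all add: size1_size)
  then have "covers_gap f ?i k v \<longleftrightarrow> k = j \<and> v = ?v" for k v
    by (auto simp: covers_gap_def)
  then show ?thesis
    using label_at_last_common_vertex[OF assms] by (simp add: forest_perm_def)
qed

lemma forest_perm_cases:
  obtains (star) j where "i = offset f j"
  | (concrete) j m where "i = Suc (offset f j + m)" "m < size (f j)"
proof -
  obtain j m where "i = offset f j + m" "m < size1 (f j)" by (rule offset_decomposition)
  then show thesis using star[of j] concrete[of j "m - 1"] by (cases m) (auto simp: size1_size)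
qed

lemma star_positions_forest_perm: "{i. forest_perm f i = \<infinity>} = range (offset f)"
proof (intro set_eqI iffI)
  fix i assume "i \<in> {i. forest_perm f i = \<infinity>}"
  then show "i \<in> range (offset f)"
    by (cases i rule: forest_perm_cases[of _ f]) (auto simp: forest_perm_inner)
qed (auto simp: forest_perm_offset)

lemma set_tree_forest_perm:
  "x \<in> set_tree (f j) \<longleftrightarrow> (\<exists>m<size (f j). forest_perm f (Suc (offset f j + m)) = enat x)"
proof -
  have "x \<in> set_tree (f j) \<longleftrightarrow> (\<exists>m<size (f j). inorder (f j) ! m = x)"
    using in_set_conv_nth[of x "inorder (f j)"] by simp
  then show ?thesis by (auto simp: forest_perm_inner)
qed

text \<open>
  A set of natural numbers has only one increasing enumeration; hence the set of the stars
  of a sequence determines where the trees begin.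
\<close>

lemma strict_mono_eq_if_range_eq:
  fixes f g :: "nat \<Rightarrow> nat"
  assumes f: "strict_mono f" and g: "strict_mono g" and eq: "range f = range g"
  shows "f = g"
proof
  fix n
  have le: "v n \<le> u n"
    if uv: "strict_mono u" "range u = range v" "strict_mono v" "\<forall>k<n. u k = v k"
    for u v :: "nat \<Rightarrow> nat" and n
  proof -
    obtain m where m: "u n = v m" using uv(2) by (metis rangeE rangeI)
    then have "\<not> m < n" using uv by (metis less_irrefl strict_mono_less)
    then show ?thesis using m uv(3) by (simp add: strict_mono_less_eq)
  qed
  show "f n = g n"
  proof (induction n rule: less_induct)
    case (less n)
    then show ?case using le[of f g n] le[of g f n] f g eq by (simp add: antisym)
  qed
qed

lemma offset_eq_if_star_positions_eq:
  assumes "{i. forest_perm f i = \<infinity>} = {i. forest_perm g i = \<infinity>}"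
  shows "offset f = offset g"
  using strict_mono_eq_if_range_eq[OF strict_mono_offset strict_mono_offset] assms
  by (simp add: star_positions_forest_perm)

lemma size_eq_if_offset_eq: "offset f = offset g \<Longrightarrow> size (f j) = size (g j)"
  using offset_Suc[of f j] offset_Suc[of g j] by simp

section \<open>The shape of a decreasing tree\<close>

text \<open>
  The ancestor relation on the vertices of a decreasing tree, expressed by its inorder traversal
  (every vertex is an ancestor of itself).
\<close>

definition list_ancestor :: "nat list \<Rightarrow> nat \<Rightarrow> nat \<Rightarrow> bool" where
  "list_ancestor xs i k \<longleftrightarrow>
     i < length xs \<and> k < length xs \<and> (\<forall>j\<in>{min i k..max i k}. xs ! j \<le> xs ! k)"

lemma list_ancestor_less_length:
  "list_ancestor xs i k \<Longrightarrow> i < length xs" "list_ancestor xs i k \<Longrightarrow> k < length xs"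
  by (simp_all add: list_ancestor_def)

lemma segment_shift:
  "{min (c + a) (c + b)..max (c + a) (c + b)} = (+) c ` {min a b..max a (b::nat)}"
  by (cases "a \<le> b") (simp_all add: image_add_atLeastAtMost)

text \<open>
  The recursive structure of the relation: the root is an ancestor of everything, and no vertex
  of a subtree is an ancestor of something outside of that subtree, because the root,
  which is larger, would lie in between.
\<close>

lemma list_ancestor_root:
  assumes lt: "\<forall>y \<in> set xs \<union> set ys. y < x"
  shows "list_ancestor (xs @ x # ys) i k \<longleftrightarrow>
     (if k < length xs then list_ancestor xs i k
      else if k = length xs then i \<le> length xs + length ys
      else length xs < i \<and> list_ancestor ys (i - Suc (length xs)) (k - Suc (length xs)))"
proof -
  let ?zs = "xs @ x # ys" and ?p = "length xs"
  have nthr: "?zs ! c = ys ! (c - Suc ?p)" if "?p < c" for c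
    using that by (simp add: nth_append)
  have root: "?zs ! c < x" if "c < length ?zs" "c \<noteq> ?p" for c
    using that lt by (cases "c < ?p") (auto simp: nth_append nth_Cons')
  have far: "\<not> list_ancestor ?zs i k" if "k \<noteq> ?p" "min i k \<le> ?p" "?p \<le> max i k"
  proof
    assume a: "list_ancestor ?zs i k"
    moreover have "?p \<in> {min i k..max i k}" using that by simp
    ultimately have "?zs ! ?p \<le> ?zs ! k" unfolding list_ancestor_def by blast
    moreover have "?zs ! k < x" using root a that by (auto simp: list_ancestor_def)
    ultimately show False by simp
  qed
  consider "k < ?p" "i < ?p" | "k = ?p" | "?p < k" "?p < i" | "k \<noteq> ?p" "min i k \<le> ?p" "?p \<le> max i k"
    by linarith
  then show ?thesis
  proof cases
    case 1
    then show ?thesis by (auto simp: list_ancestor_def nth_append)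
  next
    case 2
    have "?zs ! j \<le> x" if "j < length ?zs" for j
      using root[of j] that by (cases "j = ?p") auto
    then show ?thesis using 2 by (auto simp: list_ancestor_def)
  next
    case 3
    have shift: "{min i k..max i k} =
        (+) (Suc ?p) ` {min (i - Suc ?p) (k - Suc ?p)..max (i - Suc ?p) (k - Suc ?p)}"
      using 3 segment_shift[of "Suc ?p" "i - Suc ?p" "k - Suc ?p"] by simp
    show ?thesis using 3 unfolding list_ancestor_def shift by (auto simp: nthr)
  next
    case 4
    then show ?thesis using far by (auto simp: list_ancestor_def)
  qed
qed

text \<open>
  Both sides split in the same way along \<open>list_ancestor_root\<close>, once it is known that equal ancestor
  relations put the root in the same place.
\<close>

lemma shape_eq_iff:
  assumes "decreasing_tree t" "decreasing_tree u"
  shows "map_tree (\<lambda>_. ()) t = map_tree (\<lambda>_. ()) u \<longleftrightarrow>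
     size t = size u \<and> list_ancestor (inorder t) = list_ancestor (inorder u)"
  using assms
proof (induction t arbitrary: u)
  case Leaf
  then show ?case by (cases u) auto
next
  case (Node l x r)
  show ?case
  proof (cases u)
    case Leaf
    then show ?thesis by simp
  next
    case u: (Node l' x' r')
    have lt: "\<forall>y \<in> set (inorder l) \<union> set (inorder r). y < x"
             "\<forall>y \<in> set (inorder l') \<union> set (inorder r'). y < x'"
      using Node.prems u by simp_all
    note anc = list_ancestor_root[OF lt(1)] list_ancestor_root[OF lt(2)]
    have IH: "map_tree (\<lambda>_. ()) l = map_tree (\<lambda>_. ()) l' \<longleftrightarrow>
        size l = size l' \<and> list_ancestor (inorder l) = list_ancestor (inorder l')"
      "map_tree (\<lambda>_. ()) r = map_tree (\<lambda>_. ()) r' \<longleftrightarrow>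
        size r = size r' \<and> list_ancestor (inorder r) = list_ancestor (inorder r')"
      using Node.IH Node.prems u by auto
    show ?thesis (is "?L \<longleftrightarrow> ?R")
    proof
      assume ?L
      then show ?R using IH u by (auto simp: anc fun_eq_iff)
    next
      assume R: ?R
      then have sz: "size l + size r = size l' + size r'" using u by simp
      have eq: "list_ancestor (inorder l @ x # inorder r) i k =
                list_ancestor (inorder l' @ x' # inorder r') i k" for i k
        using R u by (simp add: fun_eq_iff)
      \<comment> \<open>The root is the only vertex that is an ancestor of both the first and the last one.\<close>
      have left: "size l = size l'"
      proof (rule ccontr)
        assume ne: "size l \<noteq> size l'"
        have "list_ancestor (inorder l @ x # inorder r) i (size l)" if "i \<le> size l + size r" for i
          using that by (simp add: anc)
        then have all: "list_ancestor (inorder l' @ x' # inorder r') i (size l)"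
          if "i \<le> size l + size r" for i
          using that eq by simp
        show False
          using all[of 0] all[of "size l + size r"] ne sz
          by (auto simp: anc split: if_splits dest: list_ancestor_less_length)
      qed
      then have right: "size r = size r'" using sz by simp
      have "list_ancestor (inorder l) i k = list_ancestor (inorder l') i k" for i k
        using eq[of i k] left by (cases "k < size l") (auto simp: anc dest: list_ancestor_less_length)
      moreover have "list_ancestor (inorder r) i k = list_ancestor (inorder r') i k" for i k
        using eq[of "Suc (size l + i)" "Suc (size l + k)"] left by (simp add: anc)
      ultimately show ?L using IH left right u by (auto simp: fun_eq_iff)
    qed
  qed
qed

lemma tree_eq_if_shape_and_inorder_eq:
  "map_tree (\<lambda>_. ()) t = map_tree (\<lambda>_. ()) u \<Longrightarrow> inorder t = inorder u \<Longrightarrow> t = u"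
proof (induction t arbitrary: u)
  case Leaf
  then show ?case by (cases u) auto
next
  case (Node l x r)
  then obtain l' x' r' where u: "u = \<langle>l', x', r'\<rangle>" by (cases u) auto
  have "size l = size l'" using Node.prems u by (metis size_map_tree tree.map(2) tree.inject)
  then show ?case using Node u by simp
qed

text \<open>
  The maximum becomes the root, and the two parts of the list around it become the subtrees.
\<close>

lemma ex_decreasing_tree:
  "distinct xs \<Longrightarrow> \<exists>t. inorder t = xs \<and> decreasing_tree t"
proof (induction xs rule: length_induct)
  case (1 xs)
  show ?case
  proof (cases "xs = []")
    case True
    then have "inorder \<langle>\<rangle> = xs \<and> decreasing_tree \<langle>\<rangle>" by simp
    then show ?thesis by blast
  next
    case False
    then have "Max (set xs) \<in> set xs" by simp
    then obtain ys zs where xs: "xs = ys @ Max (set xs) # zs" by (meson split_list)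
    define x where "x = Max (set xs)"
    have xs': "xs = ys @ x # zs" using xs x_def by simp
    obtain l r where lr: "inorder l = ys" "decreasing_tree l" "inorder r = zs" "decreasing_tree r"
      using 1 xs' by (metis distinct.simps(2) distinct_append length_append length_Cons
          less_add_Suc1 less_add_Suc2 add_Suc_right)
    have "y < x" if "y \<in> set ys \<union> set zs" for y
    proof -
      have "y \<in> set xs" using that by (subst xs') auto
      then have "y \<le> x" by (simp add: x_def)
      moreover have "y \<noteq> x" using that 1 xs' by auto
      ultimately show ?thesis by simp
    qed
    then have "inorder \<langle>l, x, r\<rangle> = xs \<and> decreasing_tree \<langle>l, x, r\<rangle>"
      using lr xs' by (auto simp flip: set_inorder)
    then show ?thesis by blast
  qed
qed

section \<open>The congruence in terms of the sequences\<close>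

text \<open>
  The maximum at \<open>k\<close> is concrete, so no star, in particular not the one at
  position 0, can lie between \<open>i\<close> and \<open>k\<close>.
\<close>

definition ancestor :: "star_seq \<Rightarrow> nat \<Rightarrow> nat \<Rightarrow> bool" where
  "ancestor \<sigma> i k \<longleftrightarrow> \<sigma> k \<noteq> \<infinity> \<and> (\<forall>j\<in>{min i k..max i k}. \<sigma> j \<le> \<sigma> k)"

lemma ancestor_refl: "ancestor \<sigma> i i \<longleftrightarrow> \<sigma> i \<noteq> \<infinity>"
  by (simp add: ancestor_def)

lemma ancestor_concrete:
  assumes "ancestor \<sigma> i k" "j \<in> {min i k..max i k}"
  shows "\<sigma> j \<noteq> \<infinity>"
  using assms by (metis ancestor_def enat_ord_simps(5))

lemma star_positions_eq_if_ancestor_eq: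
  "ancestor \<rho> = ancestor \<sigma> \<Longrightarrow> \<rho> i = \<infinity> \<longleftrightarrow> \<sigma> i = \<infinity>"
  by (metis ancestor_refl)

lemma ancestor_forest_perm_within:
  assumes "a < size (f j)" "b < size (f j)"
  shows "ancestor (forest_perm f) (Suc (offset f j + a)) (Suc (offset f j + b)) \<longleftrightarrow>
     list_ancestor (inorder (f j)) a b"
proof -
  note shift = segment_shift[of "Suc (offset f j)" a b, unfolded add_Suc]
  have "c < size (f j)" if "c \<in> {min a b..max a b}" for c
    using that assms by auto
  then show ?thesis
    using assms unfolding ancestor_def list_ancestor_def shift
    by (simp add: forest_perm_inner)
qed

text \<open>
  Different trees are separated by a star, so the relation on the whole sequence is the disjoint
  union of the relations on the trees.
\<close>

lemma ancestor_forest_perm_iff: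
  "ancestor (forest_perm f) i k \<longleftrightarrow>
     (\<exists>j a b. i = Suc (offset f j + a) \<and> k = Suc (offset f j + b) \<and> list_ancestor (inorder (f j)) a b)"
  (is "?L \<longleftrightarrow> ?R")
proof
  assume L: ?L
  note concrete = ancestor_concrete[OF L]
  obtain j a where i: "i = Suc (offset f j + a)" "a < size (f j)"
    using concrete[of i] by (cases i rule: forest_perm_cases[of _ f]) (auto simp: forest_perm_offset)
  obtain j' b where k: "k = Suc (offset f j' + b)" "b < size (f j')"
    using concrete[of k] by (cases k rule: forest_perm_cases[of _ f]) (auto simp: forest_perm_offset)
  have mono: "offset f (Suc c) \<le> offset f d" if "c < d" for c d
    using that strict_mono_less_eq[OF strict_mono_offset, of f "Suc c" d] by simp
  have "j = j'"
  proof (rule linorder_cases[of j j'])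
    assume "j < j'"
    then show ?thesis
      using concrete[of "offset f j'"] mono[of j j'] i k by (simp add: forest_perm_offset offset_Suc)
  next
    assume "j' < j"
    then show ?thesis
      using concrete[of "offset f j"] mono[of j' j] i k by (simp add: forest_perm_offset offset_Suc)
  qed
  then show ?R using L i k ancestor_forest_perm_within[of a f j b] by blast
next
  assume ?R
  then show ?L using ancestor_forest_perm_within by (force simp: list_ancestor_def)
qed

text \<open>
  Shapes fix the sizes of the trees and hence their offsets.  Conversely the
  ancestor relation shows, by its diagonal, where the stars are, and so where each tree begins.
\<close>

lemma delete_labels_eq_iff:
  assumes "\<And>j. decreasing_tree (f j)" "\<And>j. decreasing_tree (g j)"
  shows "delete_labels f = delete_labels g \<longleftrightarrow> ancestor (forest_perm f) = ancestor (forest_perm g)"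
proof
  assume L: "delete_labels f = delete_labels g"
  then have "size (f j) = size (g j) \<and> list_ancestor (inorder (f j)) = list_ancestor (inorder (g j))" for j
    using shape_eq_iff[OF assms, of j j] fun_cong[OF L[unfolded delete_labels_def], of j] by simp
  then have sz: "\<And>j. size (f j) = size (g j)"
    and anc: "\<And>j. list_ancestor (inorder (f j)) = list_ancestor (inorder (g j))"
    by blast+
  have off: "offset f = offset g" by (simp add: offset_def size1_size sz fun_eq_iff)
  show "ancestor (forest_perm f) = ancestor (forest_perm g)"
    by (intro ext) (simp only: ancestor_forest_perm_iff off anc)
next
  assume R: "ancestor (forest_perm f) = ancestor (forest_perm g)"
  then have off: "offset f = offset g"
    by (intro offset_eq_if_star_positions_eq) (simp add: star_positions_eq_if_ancestor_eq[OF R])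
  note sz = size_eq_if_offset_eq[OF off]
  have "list_ancestor (inorder (f j)) a b = list_ancestor (inorder (g j)) a b" for j a b
    using ancestor_forest_perm_within[of a f j b] ancestor_forest_perm_within[of a g j b] R off sz
    by (cases "a < size (f j) \<and> b < size (f j)") (auto simp: list_ancestor_def)
  then have "map_tree (\<lambda>_. ()) (f j) = map_tree (\<lambda>_. ()) (g j)" for j
    using shape_eq_iff[OF assms, of j j] sz by (simp add: fun_eq_iff)
  then show "delete_labels f = delete_labels g" by (simp add: delete_labels_def)
qed

text \<open>
  Equal sequences have equal ancestors, hence equal shapes; the inorder
  traversals then give the labels.
\<close>

lemma inj_on_forest_perm: "inj_on forest_perm {f. \<exists>n. linearized_forest n f}"
proof (rule inj_onI)
  fix f g
  assume "f \<in> {f. \<exists>n. linearized_forest n f}" "g \<in> {f. \<exists>n. linearized_forest n f}"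
    and eq: "forest_perm f = forest_perm g"
  then have dec: "decreasing_tree (f j)" "decreasing_tree (g j)" for j
    by (auto simp: linearized_forest_def)
  have off: "offset f = offset g" by (rule offset_eq_if_star_positions_eq) (simp add: eq)
  note sz = size_eq_if_offset_eq[OF off]
  have "inorder (f j) = inorder (g j)" for j
  proof (rule nth_equalityI)
    fix m assume "m < length (inorder (f j))"
    then show "inorder (f j) ! m = inorder (g j) ! m"
      using forest_perm_inner[of m f j] forest_perm_inner[of m g j] eq off sz by simp
  qed (simp add: sz)
  moreover have "delete_labels f = delete_labels g"
    by (simp add: delete_labels_eq_iff[OF dec] eq)
  then have "map_tree (\<lambda>_. ()) (f j) = map_tree (\<lambda>_. ()) (g j)" for j
    unfolding delete_labels_def by (rule fun_cong)
  ultimately show "f = g" using tree_eq_if_shape_and_inorder_eq by blast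
qed

lemma star_perm_value:
  assumes \<sigma>: "star_perm n \<sigma>" and "\<sigma> i \<noteq> \<infinity>"
  obtains k where "1 \<le> k" "k \<le> n" "\<sigma> i = enat k" "1 \<le> i"
proof -
  have i: "1 \<le> i" using assms by (cases i) (auto simp: star_perm_def)
  then have "\<sigma> i \<in> enat ` {1..n}" using assms by (auto simp: star_perm_def)
  then show thesis using that i by auto
qed

lemma star_perm_inj:
  assumes \<sigma>: "star_perm n \<sigma>" and eq: "\<sigma> i = \<sigma> j" and "\<sigma> i \<noteq> \<infinity>"
  shows "i = j"
proof -
  obtain k where k: "1 \<le> k" "k \<le> n" "\<sigma> i = enat k" "1 \<le> i"
    using star_perm_value[OF \<sigma> assms(3)] .
  have "1 \<le> j" using \<sigma> eq assms(3) by (cases j) (auto simp: star_perm_def)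
  moreover have "\<exists>!i. 1 \<le> i \<and> \<sigma> i = enat k" using \<sigma> k by (simp add: star_perm_def)
  ultimately show ?thesis using k eq by auto
qed

lemma star_perm_bounds:
  assumes "star_perm n \<sigma>" "\<sigma> i = enat k"
  shows "1 \<le> i" "1 \<le> k" "k \<le> n"
proof -
  have "\<sigma> i \<noteq> \<infinity>" using assms(2) by simp
  then obtain m where "1 \<le> m" "m \<le> n" "\<sigma> i = enat m" "1 \<le> i"
    by (rule star_perm_value[OF assms(1)])
  then show "1 \<le> i" "1 \<le> k" "k \<le> n" using assms(2) by simp_all
qed

lemma star_perm_position:
  assumes "star_perm n \<sigma>" "1 \<le> k" "k \<le> n"
  obtains i where "1 \<le> i" "\<sigma> i = enat k"
proof -
  have "\<exists>!i. 1 \<le> i \<and> \<sigma> i = enat k" using assms by (simp add: star_perm_def)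
  then show thesis using that by blast
qed

lemma finite_concrete:
  assumes "star_perm n \<sigma>"
  shows "finite {i. \<sigma> i \<noteq> \<infinity>}"
proof (rule inj_on_finite)
  show "inj_on \<sigma> {i. \<sigma> i \<noteq> \<infinity>}" using star_perm_inj[OF assms] by (auto intro: inj_onI)
  show "\<sigma> ` {i. \<sigma> i \<noteq> \<infinity>} \<subseteq> enat ` {1..n}"
  proof
    fix v assume "v \<in> \<sigma> ` {i. \<sigma> i \<noteq> \<infinity>}"
    then obtain i where i: "v = \<sigma> i" "\<sigma> i \<noteq> \<infinity>" by blast
    obtain k where "1 \<le> k" "k \<le> n" "\<sigma> i = enat k" using star_perm_value[OF assms i(2)] .
    then show "v \<in> enat ` {1..n}" using i by simp
  qed
qed simp

text \<open>
  The trees are the decreasing trees of the runs between successive stars.  There are infinitely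
  many stars, as only finitely many positions are concrete, so these runs can be numbered by
  all natural numbers; almost all of them are empty and give trivial trees.
\<close>

lemma ex_linearized_forest:
  assumes \<sigma>: "star_perm n \<sigma>"
  obtains f where "linearized_forest n f" "forest_perm f = \<sigma>"
proof -
  define S where "S = {i. \<sigma> i = \<infinity>}"
  define s where "s = enumerate S"
  have "- S = {i. \<sigma> i \<noteq> \<infinity>}" by (auto simp: S_def)
  then have inf: "infinite S" using finite_concrete[OF \<sigma>] by (metis finite_compl infinite_UNIV_nat)
  have s0: "s 0 = 0" using \<sigma> by (auto simp: s_def S_def enumerate_0 star_perm_def intro: Least_equality)
  have s_in: "\<sigma> (s j) = \<infinity>" for j using enumerate_in_set[OF inf, of j] by (simp add: s_def S_def)
  have s_less: "s j < s (Suc j)" for j using enumerate_step[OF inf] by (simp add: s_def)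
  have gap: "\<sigma> i \<noteq> \<infinity>" if "s j < i" "i < s (Suc j)" for i j
    using that not_less_Least[of i "\<lambda>i. i \<in> S \<and> s j < i"]
    by (auto simp: s_def S_def enumerate_Suc'' inf[unfolded S_def])
  have "\<exists>t. inorder t = map (\<lambda>i. the_enat (\<sigma> i)) [Suc (s j)..<s (Suc j)] \<and> decreasing_tree t" for j
  proof (rule ex_decreasing_tree)
    show "distinct (map (\<lambda>i. the_enat (\<sigma> i)) [Suc (s j)..<s (Suc j)])"
      unfolding distinct_map
    proof (intro conjI inj_onI)
      fix a b assume "a \<in> set [Suc (s j)..<s (Suc j)]" "b \<in> set [Suc (s j)..<s (Suc j)]"
        "the_enat (\<sigma> a) = the_enat (\<sigma> b)"
      then show "a = b" using gap[of j a] gap[of j b] star_perm_inj[OF \<sigma>, of a b] by auto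
    qed simp
  qed
  then obtain f where f: "\<And>j. inorder (f j) = map (\<lambda>i. the_enat (\<sigma> i)) [Suc (s j)..<s (Suc j)]"
      and dec: "\<And>j. decreasing_tree (f j)"
    by metis
  have sz: "size (f j) = s (Suc j) - Suc (s j)" for j
    using arg_cong[OF f[of j], of length] by simp
  have off: "offset f j = s j" for j
  proof (induction j)
    case 0
    then show ?case by (simp add: offset_def s0)
  next
    case (Suc j)
    then show ?case using s_less[of j] by (simp add: offset_Suc sz)
  qed
  have fp: "forest_perm f = \<sigma>"
  proof
    fix i
    show "forest_perm f i = \<sigma> i"
    proof (cases i rule: forest_perm_cases[of _ f])
      case (star j)
      then show ?thesis using s_in off forest_perm_offset[of f j] by simp
    next
      case (concrete j m)
      then have less: "Suc (s j + m) < s (Suc j)" using sz by simp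
      have i: "i = Suc (s j) + m" using concrete(1) off by simp
      then obtain v where v: "\<sigma> i = enat v" using gap[of j i] less by auto
      have "[Suc (s j)..<s (Suc j)] ! m = i" using less i by (subst nth_upt) simp_all
      then have "inorder (f j) ! m = v" using concrete(2) v by (simp add: f sz)
      then show ?thesis using forest_perm_inner[of m f j] concrete v by simp
    qed
  qed
  have st: "x \<in> set_tree (f j) \<longleftrightarrow> (\<exists>m<size (f j). \<sigma> (Suc (s j + m)) = enat x)" for x j
    using set_tree_forest_perm[of x f j] by (simp only: fp off)
  have s_mono: "strict_mono s" using s_less by (simp add: strict_mono_Suc_iff)
  have "linearized_forest n f"
    unfolding linearized_forest_def
  proof (intro conjI allI impI)
    have "inj_on (\<lambda>j. Suc (s j)) {j. f j \<noteq> \<langle>\<rangle>}"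
      using strict_mono_eq[OF s_mono] by (simp add: inj_on_def)
    moreover have "Suc (s j) \<in> {i. \<sigma> i \<noteq> \<infinity>}" if "f j \<noteq> \<langle>\<rangle>" for j
    proof -
      have "size (f j) \<noteq> 0" using that by simp
      then have "Suc (s j) < s (Suc j)" using sz[of j] by linarith
      then show ?thesis using gap[of j "Suc (s j)"] by blast
    qed
    ultimately show "finite {j. f j \<noteq> \<langle>\<rangle>}"
      using inj_on_finite[OF _ _ finite_concrete[OF \<sigma>]] by blast
  next
    fix j
    show "decreasing_tree (f j)" by (rule dec)
    show "distinct (inorder (f j))"
      unfolding distinct_conv_nth
    proof (intro allI impI)
      fix a b assume ab: "a < length (inorder (f j))" "b < length (inorder (f j))" "a \<noteq> b"
      then show "inorder (f j) ! a \<noteq> inorder (f j) ! b"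
        using forest_perm_inner[of a f j] forest_perm_inner[of b f j]
          star_perm_inj[OF \<sigma>, of "Suc (s j + a)" "Suc (s j + b)"] by (auto simp: fp off)
    qed
  next
    fix j k :: nat assume jk: "j \<noteq> k"
    show "set_tree (f j) \<inter> set_tree (f k) = {}"
    proof (rule ccontr)
      assume "set_tree (f j) \<inter> set_tree (f k) \<noteq> {}"
      then obtain x a b where "a < size (f j)" "\<sigma> (Suc (s j + a)) = enat x"
          "b < size (f k)" "\<sigma> (Suc (s k + b)) = enat x"
        using st by blast
      then show False
        using star_perm_inj[OF \<sigma>, of "Suc (s j + a)" "Suc (s k + b)"]
          offset_decomposition_unique(1)[of f j a k b] jk by (simp add: off size1_size)
    qed
  next
    show "(\<Union>j. set_tree (f j)) = {1..n}"
    proof (intro set_eqI iffI)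
      fix x assume "x \<in> (\<Union>j. set_tree (f j))"
      then obtain i where i: "\<sigma> i = enat x" using st by blast
      then show "x \<in> {1..n}" using star_perm_bounds[OF \<sigma>] by simp
    next
      fix x assume "x \<in> {1..n}"
      then have "1 \<le> x" "x \<le> n" by simp_all
      then obtain i where i: "\<sigma> i = enat x" by (rule star_perm_position[OF \<sigma>])
      then obtain j m where "i = Suc (offset f j + m)" "m < size (f j)"
        by (cases i rule: forest_perm_cases[of _ f]) (auto simp: s_in off)
      then show "x \<in> (\<Union>j. set_tree (f j))" using st off i by auto
    qed
  qed
  then show thesis using that fp by blast
qed

lemma perm_forest_inverse:
  assumes "star_perm n \<sigma>"
  shows "\<exists>n. linearized_forest n (perm_forest \<sigma>)" "forest_perm (perm_forest \<sigma>) = \<sigma>"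
proof -
  obtain f where f: "linearized_forest n f" "forest_perm f = \<sigma>" by (rule ex_linearized_forest[OF assms])
  then have "perm_forest \<sigma> = f"
    unfolding perm_forest_def using the_inv_into_f_f[OF inj_on_forest_perm, of f] by blast
  then show "\<exists>n. linearized_forest n (perm_forest \<sigma>)" "forest_perm (perm_forest \<sigma>) = \<sigma>"
    using f by auto
qed

text \<open>
  This turns a statement about trees into one about maxima of intervals of the sequence.
\<close>

lemma forest_equiv_iff:
  assumes "star_perm m \<rho>" "star_perm n \<sigma>"
  shows "\<rho> \<sim> \<sigma> \<longleftrightarrow> ancestor \<rho> = ancestor \<sigma>"
proof -
  have "decreasing_tree (perm_forest \<rho> j)" "decreasing_tree (perm_forest \<sigma> j)" for j
    using perm_forest_inverse(1)[OF assms(1)] perm_forest_inverse(1)[OF assms(2)]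
    by (auto simp: linearized_forest_def)
  from delete_labels_eq_iff[of "perm_forest \<rho>" "perm_forest \<sigma>", OF this] show ?thesis
    unfolding forest_equiv_def perm_forest_inverse(2)[OF assms(1)] perm_forest_inverse(2)[OF assms(2)] .
qed

section \<open>Exchanging two consecutive symbols\<close>

text \<open>
  Inversions are pairs of positions, not of symbols, which is what makes the left weak order
  inclusion.  A star never takes part in one.
\<close>

definition inversions :: "star_seq \<Rightarrow> (nat \<times> nat) set" where
  "inversions \<sigma> = {(a, b). a < b \<and> \<sigma> b < \<sigma> a \<and> \<sigma> a \<noteq> \<infinity>}"

lemma star_perms_onD:
  assumes "\<sigma> \<in> star_perms_on n P"
  shows "star_perm n \<sigma>" "\<sigma> i \<noteq> \<infinity> \<longleftrightarrow> i \<in> P"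
proof -
  show *: "star_perm n \<sigma>" using assms by (simp add: star_perms_on_def)
  then have "1 \<le> i" if "\<sigma> i \<noteq> \<infinity>" using star_perm_value[OF * that] by blast
  then show "\<sigma> i \<noteq> \<infinity> \<longleftrightarrow> i \<in> P"
    using assms by (auto simp: star_perms_on_def concrete_positions_def)
qed

lemma inversions_subset:
  assumes "\<sigma> \<in> star_perms_on n P"
  shows "inversions \<sigma> \<subseteq> P \<times> P"
proof -
  have "\<sigma> b \<noteq> \<infinity>" if "\<sigma> b < \<sigma> a" for a b using that by (cases "\<sigma> b") auto
  then show ?thesis using star_perms_onD(2)[OF assms] by (auto simp: inversions_def)
qed

lemma finite_inversions:
  assumes "finite P" "\<sigma> \<in> star_perms_on n P"
  shows "finite (inversions \<sigma>)"
  using finite_subset[OF inversions_subset[OF assms(2)]] assms(1) by simp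

lemma transpose_consecutive_less_iff:
  fixes u v :: enat
  assumes "{u, v} \<noteq> {enat i, enat (i + 1)}"
  shows "transpose (enat i) (enat (i + 1)) u < transpose (enat i) (enat (i + 1)) v \<longleftrightarrow> u < v"
  using assms by (cases u; cases v) (auto simp: transpose_def)

context
  fixes n P \<sigma> \<rho> i x y
  assumes \<sigma>: "\<sigma> \<in> star_perms_on n P"
    and x: "\<sigma> x = enat i" and y: "\<sigma> y = enat (i + 1)"
    and \<rho>: "\<rho> = transpose (enat i) (enat (i + 1)) \<circ> \<sigma>"
begin

lemma exchange_values: "\<rho> x = enat (i + 1)" "\<rho> y = enat i"
  by (simp_all add: \<rho> x y)

text \<open>
  No symbol lies between two consecutive ones, so only the comparison of these two with
  each other changes.
\<close>

lemma exchange_less_iff: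
  assumes "{u, v} \<noteq> {x, y}"
  shows "\<rho> u < \<rho> v \<longleftrightarrow> \<sigma> u < \<sigma> v"
proof -
  have "{\<sigma> u, \<sigma> v} \<noteq> {enat i, enat (i + 1)}"
  proof
    assume eq: "{\<sigma> u, \<sigma> v} = {enat i, enat (i + 1)}"
    have "w \<in> {x, y}" if "\<sigma> w \<in> {enat i, enat (i + 1)}" for w
      using that star_perm_inj[OF star_perms_onD(1)[OF \<sigma>], of w x]
        star_perm_inj[OF star_perms_onD(1)[OF \<sigma>], of w y] x y by auto
    then have "u \<in> {x, y}" "v \<in> {x, y}" using eq by blast+
    moreover have "u \<noteq> v" using eq by (auto simp: doubleton_eq_iff)
    ultimately show False using assms by auto
  qed
  then show ?thesis unfolding \<rho> comp_def by (rule transpose_consecutive_less_iff)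
qed

lemma exchange_infinity_iff: "\<rho> u = \<infinity> \<longleftrightarrow> \<sigma> u = \<infinity>"
  by (cases "\<sigma> u") (auto simp: \<rho> transpose_def)

lemma exchange_in_star_perms_on: "\<rho> \<in> star_perms_on n P"
proof -
  have sp: "star_perm n \<sigma>" by (rule star_perms_onD(1)[OF \<sigma>])
  have bounds: "1 \<le> i" "i + 1 \<le> n"
    using star_perm_bounds[OF sp x] star_perm_bounds[OF sp y] by simp_all
  let ?t = "transpose i (i + 1)"
  have val: "\<rho> a = enat k \<longleftrightarrow> \<sigma> a = enat (?t k)" for a k
    by (cases "\<sigma> a") (auto simp: \<rho> transpose_def)
  have t: "?t k \<in> {1..n}" if "k \<in> {1..n}" for k using that bounds by (auto simp: transpose_def)
  have "\<exists>!a. 1 \<le> a \<and> \<rho> a = enat k" if "k \<in> {1..n}" for k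
    unfolding val using sp t[OF that] by (simp add: star_perm_def)
  moreover have "\<rho> a \<in> insert \<infinity> (enat ` {1..n})" if "1 \<le> a" for a
  proof (cases "\<sigma> a")
    case (enat k)
    then have "k \<in> {1..n}" using star_perm_bounds[OF sp, of a k] by simp
    moreover have "\<rho> a = enat (?t k)" using enat by (simp add: val)
    ultimately show ?thesis using t by blast
  qed (simp add: \<rho> transpose_def)
  moreover have "\<rho> 0 = \<infinity>" using sp exchange_infinity_iff by (simp add: star_perm_def)
  ultimately have "star_perm n \<rho>" by (simp add: star_perm_def)
  then show ?thesis using \<sigma> exchange_infinity_iff
    by (simp add: star_perms_on_def concrete_positions_def del: not_infinity_eq)
qed

lemma inversions_exchange:
  assumes "x < y"
  shows "inversions \<rho> = insert (x, y) (inversions \<sigma>)"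
proof -
  have other: "p \<in> inversions \<rho> \<longleftrightarrow> p \<in> inversions \<sigma>" if "p \<noteq> (x, y)" for p
  proof -
    obtain a b where p: "p = (a, b)" by fastforce
    then have "{b, a} \<noteq> {x, y} \<or> \<not> a < b" using that assms by (auto simp: doubleton_eq_iff)
    then show ?thesis
      using exchange_less_iff[of b a] exchange_infinity_iff[of a]
      unfolding p inversions_def mem_Collect_eq prod.case by (cases "{b, a} = {x, y}") simp_all
  qed
  moreover have "(x, y) \<in> inversions \<rho>"
    using assms by (simp add: inversions_def exchange_values)
  ultimately have "p \<in> inversions \<rho> \<longleftrightarrow> p \<in> insert (x, y) (inversions \<sigma>)" for p
    using other[of p] by (cases "p = (x, y)") simp_all
  then show ?thesis by blast
qed

lemma inversions_exchange_back:
  assumes "y < x"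
  shows "inversions \<sigma> = insert (y, x) (inversions \<rho>)"
proof -
  have other: "p \<in> inversions \<rho> \<longleftrightarrow> p \<in> inversions \<sigma>" if "p \<noteq> (y, x)" for p
  proof -
    obtain a b where p: "p = (a, b)" by fastforce
    then have "{b, a} \<noteq> {x, y} \<or> \<not> a < b" using that assms by (auto simp: doubleton_eq_iff)
    then show ?thesis
      using exchange_less_iff[of b a] exchange_infinity_iff[of a]
      unfolding p inversions_def mem_Collect_eq prod.case by (cases "{b, a} = {x, y}") simp_all
  qed
  moreover have "(y, x) \<in> inversions \<sigma>"
    using assms by (simp add: inversions_def x y)
  ultimately have "p \<in> inversions \<sigma> \<longleftrightarrow> p \<in> insert (y, x) (inversions \<rho>)" for p
    using other[of p] by (cases "p = (y, x)") simp_all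
  then show ?thesis by blast
qed

text \<open>
  The only comparison that changes is that of \<open>x\<close> with \<open>y\<close>, and an interval that contains both
  positions also contains \<open>d\<close>, so that neither \<open>x\<close> nor \<open>y\<close> holds its maximum, before or after the
  exchange.
\<close>

lemma ancestor_exchange:
  assumes d: "\<sigma> y < \<sigma> d" "(x < d) \<noteq> (y < d)"
  shows "ancestor \<rho> = ancestor \<sigma>"
proof (intro ext)
  fix u v
  have ne: "d \<noteq> x" "d \<noteq> y" using d x y by auto
  have \<rho>d: "\<rho> y < \<rho> d" "\<rho> x < \<rho> d"
  proof -
    have "\<rho> w < \<rho> d" if "w = x \<or> w = y" for w
      using that exchange_less_iff[of w d] d x y ne by (cases "\<sigma> d") (auto simp: doubleton_eq_iff)
    then show "\<rho> y < \<rho> d" "\<rho> x < \<rho> d" by blast+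
  qed
  show "ancestor \<rho> u v = ancestor \<sigma> u v"
  proof (cases "v \<in> {x, y} \<and> (\<exists>j\<in>{min u v..max u v}. {v, j} = {x, y})")
    case True
    then obtain j where v: "v \<in> {x, y}" and j: "j \<in> {min u v..max u v}" "{v, j} = {x, y}" by blast
    then have "d \<in> {min u v..max u v}" using d ne by (auto simp: doubleton_eq_iff)
    moreover have "\<rho> v < \<rho> d" using v \<rho>d by auto
    moreover have "\<sigma> x < \<sigma> d" using x y d by (cases "\<sigma> d") auto
    then have "\<sigma> v < \<sigma> d" using v d by auto
    ultimately have "\<not> ancestor \<rho> u v" "\<not> ancestor \<sigma> u v"
      unfolding ancestor_def by (meson leD)+
    then show ?thesis by simp
  next
    case False
    then have "\<rho> v < \<rho> j \<longleftrightarrow> \<sigma> v < \<sigma> j" if "j \<in> {min u v..max u v}" for j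
      using that exchange_less_iff[of v j] by blast
    then show ?thesis unfolding ancestor_def exchange_infinity_iff
      by (simp add: linorder_not_less[symmetric])
  qed
qed

end

section \<open>The weak order and inversion sets\<close>

text \<open>
  The symbol at a position is the rank of that position in the order of symbols, and this order
  can be read off the inversions.
\<close>

lemma star_perms_on_eq_if_inversions_eq:
  assumes \<sigma>: "\<sigma> \<in> star_perms_on n P" and \<rho>: "\<rho> \<in> star_perms_on n P"
    and eq: "inversions \<sigma> = inversions \<rho>"
  shows "\<sigma> = \<rho>"
proof
  fix a
  have rank: "\<tau> a = enat (card {j \<in> P. \<tau> j \<le> \<tau> a})" if \<tau>: "\<tau> \<in> star_perms_on n P" and a: "a \<in> P" for \<tau>
  proof -
    note sp = star_perms_onD(1)[OF \<tau>] and conc = star_perms_onD(2)[OF \<tau>]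
    have "\<tau> a \<noteq> \<infinity>" using conc a by blast
    then obtain k where k: "1 \<le> k" "k \<le> n" "\<tau> a = enat k" by (rule star_perm_value[OF sp])
    have "bij_betw (\<lambda>j. the_enat (\<tau> j)) {j \<in> P. \<tau> j \<le> \<tau> a} {1..k}"
      unfolding bij_betw_def
    proof (intro conjI inj_onI set_eqI iffI)
      fix u v assume "u \<in> {j \<in> P. \<tau> j \<le> \<tau> a}" "v \<in> {j \<in> P. \<tau> j \<le> \<tau> a}" "the_enat (\<tau> u) = the_enat (\<tau> v)"
      then show "u = v" using star_perm_inj[OF sp, of u v] conc[of u] conc[of v] by auto
    next
      fix m assume "m \<in> (\<lambda>j. the_enat (\<tau> j)) ` {j \<in> P. \<tau> j \<le> \<tau> a}"
      then obtain j where j: "j \<in> P" "\<tau> j \<le> \<tau> a" "m = the_enat (\<tau> j)" by blast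
      then obtain l where l: "\<tau> j = enat l" using conc[of j] by auto
      then show "m \<in> {1..k}" using star_perm_bounds[OF sp l] j k by simp
    next
      fix m assume m: "m \<in> {1..k}"
      then have "1 \<le> m" "m \<le> n" using k by auto
      then obtain j where j: "\<tau> j = enat m" by (rule star_perm_position[OF sp])
      then have "j \<in> {j \<in> P. \<tau> j \<le> \<tau> a}" using m k conc[of j] by simp
      then show "m \<in> (\<lambda>j. the_enat (\<tau> j)) ` {j \<in> P. \<tau> j \<le> \<tau> a}" using j by force
    qed
    then have "card {j \<in> P. \<tau> j \<le> \<tau> a} = k" using bij_betw_same_card by fastforce
    then show ?thesis using k by simp
  qed
  have order: "\<tau> j \<le> \<tau> a \<longleftrightarrow> (if j < a then (j, a) \<notin> inversions \<tau> else j = a \<or> (a, j) \<in> inversions \<tau>)"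
    if \<tau>: "\<tau> \<in> star_perms_on n P" and "a \<in> P" "j \<in> P" for \<tau> j
  proof -
    have "\<tau> j \<noteq> \<infinity>" "\<tau> a \<noteq> \<infinity>" using that star_perms_onD(2)[OF \<tau>] by blast+
    then show ?thesis using star_perm_inj[OF star_perms_onD(1)[OF \<tau>], of j a]
      by (auto simp: inversions_def order.order_iff_strict)
  qed
  show "\<sigma> a = \<rho> a"
  proof (cases "a \<in> P")
    case True
    have "\<sigma> j \<le> \<sigma> a \<longleftrightarrow> \<rho> j \<le> \<rho> a" if "j \<in> P" for j
      using order[OF \<sigma> True that] order[OF \<rho> True that] eq by simp
    then have "{j \<in> P. \<sigma> j \<le> \<sigma> a} = {j \<in> P. \<rho> j \<le> \<rho> a}" by blast
    then show ?thesis using rank[OF \<sigma> True] rank[OF \<rho> True] by simp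
  next
    case False
    then show ?thesis using star_perms_onD(2)[OF \<sigma>] star_perms_onD(2)[OF \<rho>] by metis
  qed
qed

lemma weak_cover_inversions:
  assumes "weak_cover n P \<sigma> \<rho>"
  shows "\<rho> \<in> star_perms_on n P" "inversions \<sigma> \<subseteq> inversions \<rho>"
proof -
  obtain i a b where ex: "\<sigma> \<in> star_perms_on n P" "\<sigma> a = enat i" "\<sigma> b = enat (i + 1)"
      "\<rho> = transpose (enat i) (enat (i + 1)) \<circ> \<sigma>" and "a < b"
    using assms by (auto simp: weak_cover_def)
  then show "\<rho> \<in> star_perms_on n P" "inversions \<sigma> \<subseteq> inversions \<rho>"
    using exchange_in_star_perms_on[OF ex] inversions_exchange[OF ex] by auto
qed

lemma inversions_mono:
  assumes "weak_le n P \<sigma> \<rho>"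
  shows "inversions \<sigma> \<subseteq> inversions \<rho>"
  using assms unfolding weak_le_def
proof (induction rule: rtranclp_induct)
  case (step \<tau> \<rho>)
  then show ?case using weak_cover_inversions(2)[of n P \<tau> \<rho>] by simp
qed simp

text \<open>
  A pair that is inverted in \<open>\<rho>\<close> but not in \<open>\<sigma>\<close>, with the smallest possible difference of symbols in
  \<open>\<sigma>\<close>, consists of consecutive symbols.  Otherwise let \<open>c\<close> be the position of a symbol in between.
  Wherever \<open>c\<close> lies relative to \<open>a\<close> and \<open>b\<close>, one of the pairs \<open>(a, c)\<close> and \<open>(c, b)\<close>
  is of the same kind: for \<open>c\<close> outside of the interval
  from \<open>a\<close> to \<open>b\<close>, an inversion of \<open>\<sigma>\<close> is carried over to \<open>\<rho>\<close>.
\<close>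

lemma ex_consecutive_noninversion:
  assumes \<sigma>: "\<sigma> \<in> star_perms_on n P" and \<rho>: "\<rho> \<in> star_perms_on n P"
    and sub: "inversions \<sigma> \<subseteq> inversions \<rho>"
  shows "\<sigma> a = enat u \<Longrightarrow> \<sigma> b = enat v \<Longrightarrow> (a, b) \<in> inversions \<rho> \<Longrightarrow> u < v \<Longrightarrow>
    \<exists>a b i. a < b \<and> \<sigma> a = enat i \<and> \<sigma> b = enat (i + 1) \<and> (a, b) \<in> inversions \<rho>"
proof (induction "v - u" arbitrary: a b u v rule: less_induct)
  case less
  note ab = less.prems
  show ?case
  proof (cases "v = u + 1")
    case True
    then show ?thesis using ab by (auto simp: inversions_def)
  next
    case False
    then have between: "u < u + 1" "u + 1 < v" using ab by auto
    have "v \<le> n" by (rule star_perm_bounds[OF star_perms_onD(1)[OF \<sigma>] ab(2)])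
    then have "1 \<le> u + 1" "u + 1 \<le> n" using between by simp_all
    then obtain c where c: "\<sigma> c = enat (u + 1)"
      by (rule star_perm_position[OF star_perms_onD(1)[OF \<sigma>]])
    have ne: "c \<noteq> a" "c \<noteq> b" using c ab between by auto
    have inv: "a < b" "\<rho> b < \<rho> a" "\<rho> a \<noteq> \<infinity>" using ab by (auto simp: inversions_def)
    have \<rho>c: "\<rho> c \<noteq> \<infinity>" using c star_perms_onD(2)[OF \<sigma>, of c] star_perms_onD(2)[OF \<rho>, of c] by simp
    have "(a, c) \<in> inversions \<rho> \<or> (c, b) \<in> inversions \<rho>"
    proof -
      consider "c < a" | "a < c" "c < b" | "b < c" using ne by linarith
      then show ?thesis
      proof cases
        case 1
        then have "(c, a) \<in> inversions \<sigma>" using c ab by (simp add: inversions_def)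
        then have "\<rho> a < \<rho> c" using sub by (auto simp: inversions_def)
        then show ?thesis using 1 inv \<rho>c by (auto simp: inversions_def)
      next
        case 2
        moreover have "\<rho> c < \<rho> a \<or> \<rho> b < \<rho> c" using inv by (meson not_less order.strict_trans2)
        ultimately show ?thesis using inv \<rho>c by (auto simp: inversions_def)
      next
        case 3
        then have "(b, c) \<in> inversions \<sigma>" using c ab between by (simp add: inversions_def)
        then have "\<rho> c < \<rho> b" using sub by (auto simp: inversions_def)
        then show ?thesis using 3 inv by (auto simp: inversions_def)
      qed
    qed
    then show ?thesis
    proof
      assume "(a, c) \<in> inversions \<rho>"
      then show ?thesis using less.hyps[of "u + 1" u a c] ab c between by simp
    next
      assume "(c, b) \<in> inversions \<rho>"
      then show ?thesis using less.hyps[of v "u + 1" c b] ab c between by simp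
    qed
  qed
qed

text \<open>
  Each exchange of such a consecutive pair is one step up from \<open>\<sigma>\<close> and removes one pair from
  the difference of the inversion sets.
\<close>

lemma weak_le_if_inversions_subset:
  assumes "finite P" and \<rho>: "\<rho> \<in> star_perms_on n P"
  shows "\<sigma> \<in> star_perms_on n P \<Longrightarrow> inversions \<sigma> \<subseteq> inversions \<rho> \<Longrightarrow> weak_le n P \<sigma> \<rho>"
proof (induction "card (inversions \<rho> - inversions \<sigma>)" arbitrary: \<sigma> rule: less_induct)
  case less
  note \<sigma> = less.prems(1) and sub = less.prems(2)
  show ?case
  proof (cases "inversions \<sigma> = inversions \<rho>")
    case True
    then show ?thesis using star_perms_on_eq_if_inversions_eq[OF \<sigma> \<rho>] by (simp add: weak_le_def)
  next
    case False
    then obtain a b where ab: "(a, b) \<in> inversions \<rho>" "(a, b) \<notin> inversions \<sigma>" using sub by auto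
    have "a \<in> P" "b \<in> P" using inversions_subset[OF \<rho>] ab by auto
    then obtain u v where uv: "\<sigma> a = enat u" "\<sigma> b = enat v"
      using star_perms_onD(2)[OF \<sigma>] by (metis not_infinity_eq)
    have "a < b" using ab by (auto simp: inversions_def)
    then have "u \<noteq> v" "\<not> v < u"
      using ab uv star_perm_inj[OF star_perms_onD(1)[OF \<sigma>], of a b] by (auto simp: inversions_def)
    then have "u < v" by simp
    from ex_consecutive_noninversion[OF \<sigma> \<rho> sub uv ab(1) this]
    obtain x y i where xy: "x < y" "\<sigma> x = enat i" "\<sigma> y = enat (i + 1)" "(x, y) \<in> inversions \<rho>"
      by blast
    define \<tau> where "\<tau> = transpose (enat i) (enat (i + 1)) \<circ> \<sigma>"
    note ex = \<sigma> xy(2,3) \<tau>_def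
    have \<tau>: "\<tau> \<in> star_perms_on n P" "inversions \<tau> = insert (x, y) (inversions \<sigma>)"
      using exchange_in_star_perms_on[OF ex] inversions_exchange[OF ex xy(1)] by auto
    have new: "(x, y) \<notin> inversions \<sigma>" using xy by (simp add: inversions_def)
    have "finite (inversions \<rho>)" by (rule finite_inversions[OF assms])
    then have "card (inversions \<rho> - inversions \<tau>) < card (inversions \<rho> - inversions \<sigma>)"
      using \<tau>(2) new xy(4) by (intro psubset_card_mono) auto
    then have le: "weak_le n P \<tau> \<rho>" using less.hyps[of \<tau>] \<tau> sub xy(4) by simp
    have sp: "star_perm n \<sigma>" by (rule star_perms_onD(1)[OF \<sigma>])
    have "1 \<le> i" "i < n" "1 \<le> x"
      using star_perm_bounds[OF sp xy(2)] star_perm_bounds[OF sp xy(3)] by simp_all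
    then have "weak_cover n P \<sigma> \<tau>" using \<sigma> xy unfolding weak_cover_def \<tau>_def by blast
    then show ?thesis using le unfolding weak_le_def by (rule converse_rtranclp_into_rtranclp)
  qed
qed

lemma weak_le_iff_inversions:
  assumes "finite P" "\<sigma> \<in> star_perms_on n P" "\<rho> \<in> star_perms_on n P"
  shows "weak_le n P \<sigma> \<rho> \<longleftrightarrow> inversions \<sigma> \<subseteq> inversions \<rho>"
  using weak_le_if_inversions_subset[OF assms(1,3,2)] inversions_mono by blast

section \<open>Extreme elements of a congruence class\<close>

text \<open>
  Unlike in \<open>avoids_132\<close> and \<open>avoids_231\<close> the pattern may occur anywhere.  The outer
  symbols of a pattern are concrete, so for a sequence in \<open>star_perms_on n P\<close> and \<open>z = Max P\<close> the
  two notions agree.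
\<close>

definition contains_132 :: "star_seq \<Rightarrow> bool" where
  "contains_132 \<sigma> \<longleftrightarrow> (\<exists>a d c. a < d \<and> d < c \<and> \<sigma> a < \<sigma> c \<and> \<sigma> c < \<sigma> d)"

definition contains_231 :: "star_seq \<Rightarrow> bool" where
  "contains_231 \<sigma> \<longleftrightarrow> (\<exists>a d c. a < d \<and> d < c \<and> \<sigma> c < \<sigma> a \<and> \<sigma> a < \<sigma> d)"

text \<open>
  A symbol between the two outer ones lies on one side of \<open>d\<close>, and there it can replace the outer
  symbol of that side.  The statement covers 132 (\<open>x < d < y\<close>) and 231 (\<open>y < d < x\<close>) at once.
\<close>

lemma ex_consecutive_pattern:
  assumes \<sigma>: "star_perm n \<sigma>"
  shows "(x < d) \<noteq> (y < d) \<Longrightarrow> \<sigma> x = enat u \<Longrightarrow> \<sigma> y = enat v \<Longrightarrow> u < v \<Longrightarrow>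
    \<sigma> y < \<sigma> d \<Longrightarrow> \<exists>x' y' i. \<sigma> x' = enat i \<and> \<sigma> y' = enat (i + 1) \<and> \<sigma> y' < \<sigma> d \<and>
      (x' < d \<longleftrightarrow> x < d) \<and> (y' < d \<longleftrightarrow> y < d)"
proof (induction "v - u" arbitrary: x y u v rule: less_induct)
  case less
  note xy = less.prems
  show ?case
  proof (cases "v = u + 1")
    case True
    then show ?thesis using xy by blast
  next
    case False
    then have between: "u < u + 1" "u + 1 < v" using xy by auto
    have "v \<le> n" by (rule star_perm_bounds[OF \<sigma> xy(3)])
    then have "1 \<le> u + 1" "u + 1 \<le> n" using between by simp_all
    then obtain c where c: "\<sigma> c = enat (u + 1)"
      by (rule star_perm_position[OF \<sigma>])
    have cd: "\<sigma> c < \<sigma> d" using c xy between by (cases "\<sigma> d") auto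
    show ?thesis
    proof (cases "(c < d) = (x < d)")
      case True
      then show ?thesis using less.hyps[of v "u + 1" c y] xy c between by simp
    next
      case False
      then have cy: "(c < d) = (y < d)" using xy by blast
      then show ?thesis using less.hyps[of "u + 1" u x c] xy c between cd by simp
    qed
  qed
qed

text \<open>
  A member of the class with as many inversions as possible: a 132 pattern with consecutive outer
  symbols would allow to gain one more by exchanging these.
\<close>

lemma class_element_without_132:
  assumes "finite P" "\<sigma>\<^sub>0 \<in> star_perms_on n P"
  obtains hi where "hi \<in> star_perms_on n P" "ancestor hi = ancestor \<sigma>\<^sub>0" "\<not> contains_132 hi"
proof -
  let ?C = "\<lambda>\<sigma>. \<sigma> \<in> star_perms_on n P \<and> ancestor \<sigma> = ancestor \<sigma>\<^sub>0"
  have fin: "finite (P \<times> P)" using assms(1) by simp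
  have bound: "card (inversions \<sigma>) \<le> card (P \<times> P)" if "?C \<sigma>" for \<sigma>
    using that inversions_subset card_mono[OF fin] by blast
  obtain hi where hi: "?C hi" and max: "\<And>\<sigma>. ?C \<sigma> \<Longrightarrow> card (inversions \<sigma>) \<le> card (inversions hi)"
    using ex_has_greatest_nat[of ?C \<sigma>\<^sub>0 "\<lambda>\<sigma>. card (inversions \<sigma>)" "Suc (card (P \<times> P))"]
      assms(2) bound unfolding less_Suc_eq_le by blast
  have sp: "star_perm n hi" using hi star_perms_onD(1) by blast
  have "False" if pat: "a < d" "d < c" "hi a < hi c" "hi c < hi d" for a d c
  proof -
    obtain u v where uv: "hi a = enat u" "hi c = enat v" "u < v" using pat
      by (cases "hi a"; cases "hi c") auto
    have "(a < d) \<noteq> (c < d)" using pat by simp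
    from ex_consecutive_pattern[OF sp this uv pat(4)]
    obtain x y i where xy: "hi x = enat i" "hi y = enat (i + 1)" "hi y < hi d" "x < d" "\<not> y < d"
      using pat by auto
    then have "x < y" by simp
    define \<tau> where "\<tau> = transpose (enat i) (enat (i + 1)) \<circ> hi"
    note ex = conjunct1[OF hi] xy(1,2) \<tau>_def
    have "?C \<tau>" using exchange_in_star_perms_on[OF ex] ancestor_exchange[OF ex xy(3)] xy hi by simp
    moreover have "(x, y) \<notin> inversions hi" using xy by (simp add: inversions_def)
    then have "card (inversions \<tau>) = Suc (card (inversions hi))"
      using inversions_exchange[OF ex \<open>x < y\<close>] finite_inversions[OF assms(1) conjunct1[OF hi]] by simp
    ultimately show False using max[of \<tau>] by simp
  qed
  then show thesis using that hi unfolding contains_132_def by blast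
qed

text \<open>
  Dually, a member of the class with as few inversions as possible.
\<close>

lemma class_element_without_231:
  assumes "finite P" "\<sigma>\<^sub>0 \<in> star_perms_on n P"
  obtains lo where "lo \<in> star_perms_on n P" "ancestor lo = ancestor \<sigma>\<^sub>0" "\<not> contains_231 lo"
proof -
  let ?C = "\<lambda>\<sigma>. \<sigma> \<in> star_perms_on n P \<and> ancestor \<sigma> = ancestor \<sigma>\<^sub>0"
  obtain lo where lo: "?C lo" and min: "\<And>\<sigma>. ?C \<sigma> \<Longrightarrow> card (inversions lo) \<le> card (inversions \<sigma>)"
    using ex_has_least_nat[of ?C \<sigma>\<^sub>0 "\<lambda>\<sigma>. card (inversions \<sigma>)"] assms(2) by blast
  have sp: "star_perm n lo" using lo star_perms_onD(1) by blast
  have "False" if pat: "a < d" "d < c" "lo c < lo a" "lo a < lo d" for a d c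
  proof -
    obtain u v where uv: "lo c = enat u" "lo a = enat v" "u < v" using pat
      by (cases "lo a"; cases "lo c") auto
    have "(c < d) \<noteq> (a < d)" using pat by simp
    from ex_consecutive_pattern[OF sp this uv pat(4)]
    obtain x y i where xy: "lo x = enat i" "lo y = enat (i + 1)" "lo y < lo d" "\<not> x < d" "y < d"
      using pat by auto
    then have "y < x" by simp
    define \<tau> where "\<tau> = transpose (enat i) (enat (i + 1)) \<circ> lo"
    note ex = conjunct1[OF lo] xy(1,2) \<tau>_def
    have C: "?C \<tau>" using exchange_in_star_perms_on[OF ex] ancestor_exchange[OF ex xy(3)] xy lo by simp
    moreover have "(y, x) \<notin> inversions \<tau>" by (simp add: inversions_def exchange_values[OF ex])
    then have "card (inversions lo) = Suc (card (inversions \<tau>))"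
      using inversions_exchange_back[OF ex \<open>y < x\<close>] finite_inversions[OF assms(1) conjunct1[OF C]] by simp
    ultimately show False using min[of \<tau>] by simp
  qed
  then show thesis using that lo unfolding contains_231_def by blast
qed

lemma ancestor_forces_order:
  assumes "ancestor \<sigma> a b" "a \<noteq> b" "star_perm n \<sigma>"
  shows "\<sigma> a < \<sigma> b"
proof -
  have "\<sigma> a \<le> \<sigma> b" "\<sigma> b \<noteq> \<infinity>" using assms(1) by (auto simp: ancestor_def)
  then show ?thesis using star_perm_inj[OF assms(3), of b a] assms(2) by (auto simp: order.order_iff_strict)
qed

text \<open>
  If \<open>\<sigma> b < \<sigma> a\<close> with \<open>a < b\<close> and \<open>a\<close> is not an ancestor of \<open>b\<close>, then something larger than \<open>\<sigma> a\<close> lies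
  in between and completes a 231 pattern.
\<close>

lemma inversions_without_231:
  assumes \<sigma>: "star_perm n \<sigma>"
    and av: "\<not> contains_231 \<sigma>"
  shows "inversions \<sigma> = {(a, b). a < b \<and> ancestor \<sigma> b a}"
proof (intro set_eqI iffI; clarify)
  fix a b assume "(a, b) \<in> inversions \<sigma>"
  then have ab: "a < b" "\<sigma> b < \<sigma> a" "\<sigma> a \<noteq> \<infinity>" by (auto simp: inversions_def)
  have "\<sigma> j \<le> \<sigma> a" if "j \<in> {min b a..max b a}" for j
  proof (rule ccontr)
    assume "\<not> \<sigma> j \<le> \<sigma> a"
    then have less: "\<sigma> a < \<sigma> j" by simp
    then have "j \<noteq> a" "j \<noteq> b" using ab by auto
    then have "a < j" "j < b" using ab that by auto
    then show False using av ab less unfolding contains_231_def by blast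
  qed
  then show "a < b \<and> ancestor \<sigma> b a" using ab by (simp add: ancestor_def)
next
  fix a b assume "a < b" "ancestor \<sigma> b a"
  then show "(a, b) \<in> inversions \<sigma>"
    using ancestor_forces_order[OF _ _ \<sigma>, of b a] by (auto simp: inversions_def ancestor_def)
qed

text \<open>
  Likewise, if \<open>\<sigma> a < \<sigma> b\<close> with \<open>a < b\<close> and \<open>b\<close> is not an ancestor of \<open>a\<close>, then something larger than
  \<open>\<sigma> b\<close> lies in between and completes a 132 pattern.
\<close>

lemma inversions_without_132:
  assumes \<sigma>: "\<sigma> \<in> star_perms_on n P"
    and av: "\<not> contains_132 \<sigma>"
  shows "inversions \<sigma> = {(a, b) \<in> P \<times> P. a < b \<and> \<not> ancestor \<sigma> a b}"
proof (intro set_eqI iffI; clarify)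
  note sp = star_perms_onD(1)[OF \<sigma>] and conc = star_perms_onD(2)[OF \<sigma>]
  {
    fix a b assume "(a, b) \<in> inversions \<sigma>"
    moreover from this have "a < b" "\<sigma> b < \<sigma> a" by (auto simp: inversions_def)
    ultimately show "(a, b) \<in> P \<times> P \<and> a < b \<and> \<not> ancestor \<sigma> a b"
      using inversions_subset[OF \<sigma>] ancestor_forces_order[OF _ _ sp, of a b] by auto
  next
    fix a b assume ab: "a \<in> P" "b \<in> P" "a < b" "\<not> ancestor \<sigma> a b"
    show "(a, b) \<in> inversions \<sigma>"
    proof (rule ccontr)
      assume "(a, b) \<notin> inversions \<sigma>"
      then have "\<sigma> a \<le> \<sigma> b" using ab conc[of a] by (auto simp: inversions_def)
      then have lt: "\<sigma> a < \<sigma> b"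
        using ab conc[of a] star_perm_inj[OF sp, of a b] by (auto simp: order.order_iff_strict)
      obtain j where j: "j \<in> {a..b}" "\<sigma> b < \<sigma> j"
        using ab conc[of b] by (auto simp: ancestor_def not_le)
      then have "j \<noteq> a" "j \<noteq> b" using lt by auto
      then have "a < j" "j < b" using j by auto
      then show False using av lt j unfolding contains_132_def by blast
    qed
  }
qed

text \<open>
  If \<open>\<rho>\<close> respects the comparisons that the ancestors in \<open>\<sigma>\<close> force, it cannot have further ancestors:
  the maximum of \<open>\<sigma>\<close> on an interval is also the maximum of \<open>\<rho>\<close>.
\<close>

lemma ancestor_eq_if_subset:
  assumes \<sigma>: "\<sigma> \<in> star_perms_on n P" and \<rho>: "\<rho> \<in> star_perms_on n P"
    and sub: "\<And>a b. ancestor \<sigma> a b \<Longrightarrow> \<rho> a \<le> \<rho> b"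
  shows "ancestor \<rho> = ancestor \<sigma>"
proof (intro ext iffI)
  note conc = star_perms_onD(2)[OF \<sigma>] star_perms_onD(2)[OF \<rho>]
  {
    fix i k assume ik: "ancestor \<sigma> i k"
    have "ancestor \<sigma> j k" if "j \<in> {min i k..max i k}" for j
    proof -
      have "{min j k..max j k} \<subseteq> {min i k..max i k}" using that by auto
      then show ?thesis using ik unfolding ancestor_def by blast
    qed
    then have "\<rho> j \<le> \<rho> k" if "j \<in> {min i k..max i k}" for j using sub that by blast
    moreover have "\<rho> k \<noteq> \<infinity>" using ik conc by (auto simp: ancestor_def)
    ultimately show "ancestor \<rho> i k" by (simp add: ancestor_def)
  next
    fix i k assume ik: "ancestor \<rho> i k"
    let ?I = "{min i k..max i k}"
    have conc_I: "\<sigma> j \<noteq> \<infinity>" if "j \<in> ?I" for j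
      using ancestor_concrete[OF ik that] conc by blast
    have "Max (\<sigma> ` ?I) \<in> \<sigma> ` ?I" by (intro Max_in) auto
    then obtain m where m: "m \<in> ?I" "Max (\<sigma> ` ?I) = \<sigma> m" by (metis imageE)
    then have top: "\<sigma> j \<le> \<sigma> m" if "j \<in> ?I" for j using that by (metis Max_ge finite_atLeastAtMost finite_imageI imageI)
    have "k \<in> ?I" by simp
    have "{min k m..max k m} \<subseteq> ?I" using m(1) by auto
    then have "ancestor \<sigma> k m" unfolding ancestor_def using top conc_I m(1) by blast
    then have "\<rho> k \<le> \<rho> m" by (rule sub)
    moreover have "\<rho> m \<le> \<rho> k" "\<rho> k \<noteq> \<infinity>" using ik m(1) by (auto simp: ancestor_def)
    ultimately have "m = k" using star_perm_inj[OF star_perms_onD(1)[OF \<rho>], of k m] by auto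
    then show "ancestor \<sigma> i k" unfolding ancestor_def using top conc_I \<open>k \<in> ?I\<close> by blast
  }
qed

text \<open>
  The inversions of \<open>lo\<close> are the forced ones and those of \<open>hi\<close> the permitted ones, so lying between
  \<open>lo\<close> and \<open>hi\<close> means to respect the comparisons forced by the ancestors.
\<close>

lemma class_is_weak_interval:
  assumes fin: "finite P"
    and lo: "lo \<in> star_perms_on n P" "\<not> contains_231 lo"
    and hi: "hi \<in> star_perms_on n P" "\<not> contains_132 hi"
    and eq: "ancestor lo = ancestor hi"
  shows "{\<rho> \<in> star_perms_on n P. ancestor \<rho> = ancestor hi} = weak_interval n P lo hi"
proof (intro set_eqI iffI)
  note inv_lo = inversions_without_231[OF star_perms_onD(1)[OF lo(1)] lo(2)]
  note inv_hi = inversions_without_132[OF hi]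
  {
    fix \<rho> assume "\<rho> \<in> {\<rho> \<in> star_perms_on n P. ancestor \<rho> = ancestor hi}"
    then have \<rho>: "\<rho> \<in> star_perms_on n P" and anc: "ancestor \<rho> = ancestor hi" by auto
    note order = ancestor_forces_order[OF _ _ star_perms_onD(1)[OF \<rho>]]
    have "inversions lo \<subseteq> inversions \<rho>"
    proof
      fix p assume "p \<in> inversions lo"
      then obtain a b where p: "p = (a, b)" "a < b" "ancestor \<rho> b a" using inv_lo eq anc by auto
      then show "p \<in> inversions \<rho>" using order[of b a] by (auto simp: inversions_def ancestor_def)
    qed
    moreover have "inversions \<rho> \<subseteq> inversions hi"
    proof
      fix p assume p: "p \<in> inversions \<rho>"
      then obtain a b where ab: "p = (a, b)" "a < b" "\<rho> b < \<rho> a" by (auto simp: inversions_def)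
      then have "\<not> ancestor hi a b" using order[of a b] anc by auto
      then show "p \<in> inversions hi" using inversions_subset[OF \<rho>] p ab inv_hi by auto
    qed
    ultimately show "\<rho> \<in> weak_interval n P lo hi"
      using \<rho> weak_le_iff_inversions[OF fin] lo hi by (simp add: weak_interval_def)
  next
    fix \<rho> assume "\<rho> \<in> weak_interval n P lo hi"
    then have \<rho>: "\<rho> \<in> star_perms_on n P"
      and sub: "inversions lo \<subseteq> inversions \<rho>" "inversions \<rho> \<subseteq> inversions hi"
      using inversions_mono[of n P lo \<rho>] inversions_mono[of n P \<rho> hi]
      by (simp_all add: weak_interval_def)
    have "\<rho> a \<le> \<rho> b" if anc: "ancestor hi a b" for a b
    proof (cases a b rule: linorder_cases)
      case less
      then have "(a, b) \<notin> inversions \<rho>" using anc inv_hi sub by auto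
      moreover have "\<rho> a \<noteq> \<infinity>"
      proof -
        have "hi a \<noteq> \<infinity>" using ancestor_concrete[OF anc, of a] by simp
        then show ?thesis using star_perms_onD(2)[OF \<rho>] star_perms_onD(2)[OF hi(1)] by blast
      qed
      ultimately show ?thesis using less by (auto simp: inversions_def)
    next
      case greater
      then have "(b, a) \<in> inversions lo" using anc inv_lo eq by simp
      then show ?thesis using sub by (auto simp: inversions_def)
    qed simp
    then have "ancestor \<rho> = ancestor hi" by (rule ancestor_eq_if_subset[OF hi(1) \<rho>])
    then show "\<rho> \<in> {\<rho> \<in> star_perms_on n P. ancestor \<rho> = ancestor hi}" using \<rho> by simp
  }
qed

section \<open>Removing the stars\<close>

lemma star_perm_append_stars:
  assumes p: "p permutes {1..n}"
  shows "star_perm n (append_stars n p)"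
proof -
  have "\<exists>!i. 1 \<le> i \<and> append_stars n p i = enat k" if k: "k \<in> {1..n}" for k
  proof (rule ex1I)
    have "inv p k \<in> {1..n}" using permutes_in_image[OF permutes_inv[OF p]] k by blast
    then show "1 \<le> inv p k \<and> append_stars n p (inv p k) = enat k"
      using permutes_inverses(1)[OF p] by (simp add: append_stars_def)
    fix i assume "1 \<le> i \<and> append_stars n p i = enat k"
    then show "i = inv p k"
      using permutes_inverses(2)[OF p] by (auto simp: append_stars_def split: if_splits)
  qed
  moreover have "append_stars n p i \<in> insert \<infinity> (enat ` {1..n})" for i
  proof (cases "i \<in> {1..n}")
    case True
    then have "p i \<in> {1..n}" using permutes_in_image[OF p] by blast
    then show ?thesis using True by (simp add: append_stars_def)
  qed (auto simp: append_stars_def)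
  moreover have "append_stars n p 0 = \<infinity>" by (simp add: append_stars_def)
  ultimately show ?thesis unfolding star_perm_def by blast
qed

context
  fixes n :: nat and P :: "nat set"
  assumes fin: "finite P" and pos: "P \<subseteq> {1..}" and card: "card P = n"
begin

definition position :: "nat \<Rightarrow> nat" where
  "position k = sorted_list_of_set P ! (k - 1)"

lemma position_less:
  assumes "k \<in> {1..n}" "l \<in> {1..n}" "k < l"
  shows "position k < position l"
  unfolding position_def
  by (rule sorted_wrt_nth_less[OF strict_sorted_list_of_set]) (use assms fin card in auto)

lemma position_le_iff:
  assumes "k \<in> {1..n}" "l \<in> {1..n}"
  shows "position k \<le> position l \<longleftrightarrow> k \<le> l"
  using position_less[of k l] position_less[of l k] assms by (cases k l rule: linorder_cases) auto

lemma position_image: "position ` {1..n} = P"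
proof (intro set_eqI iffI)
  have len: "length (sorted_list_of_set P) = n" using fin card by simp
  {
    fix a assume "a \<in> position ` {1..n}"
    then obtain k where "k \<in> {1..n}" "a = sorted_list_of_set P ! (k - 1)" by (auto simp: position_def)
    moreover have "k - 1 < length (sorted_list_of_set P)" using calculation(1) len by auto
    ultimately have "a \<in> set (sorted_list_of_set P)" using nth_mem by blast
    then show "a \<in> P" using fin by simp
  next
    fix a assume "a \<in> P"
    then have "a \<in> set (sorted_list_of_set P)" using fin by simp
    then obtain k where "k < n" "a = sorted_list_of_set P ! k" using len by (auto simp: in_set_conv_nth)
    then have "Suc k \<in> {1..n}" "a = position (Suc k)" by (simp_all add: position_def)
    then show "a \<in> position ` {1..n}" by blast
  }
qed

lemma position_inj: "inj_on position {1..n}"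
proof (rule inj_onI)
  fix k l assume kl: "k \<in> {1..n}" "l \<in> {1..n}" "position k = position l"
  then show "k = l"
    using position_le_iff[OF kl(1,2)] position_le_iff[OF kl(2,1)] by (simp add: antisym)
qed

lemma remove_stars_position:
  assumes \<sigma>: "\<sigma> \<in> star_perms_on n P" and k: "k \<in> {1..n}"
  shows "enat (remove_stars \<sigma> k) = \<sigma> (position k)"
proof -
  have "concrete_positions \<sigma> = P" using \<sigma> by (simp add: star_perms_on_def)
  then have "remove_stars \<sigma> k = the_enat (\<sigma> (position k))"
    using k card by (simp add: remove_stars_def position_def)
  moreover have "\<sigma> (position k) \<noteq> \<infinity>" using star_perms_onD(2)[OF \<sigma>] position_image k by blast
  ultimately show ?thesis by auto
qed

lemma remove_stars_outside:
  assumes "\<sigma> \<in> star_perms_on n P" "k \<notin> {1..n}"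
  shows "remove_stars \<sigma> k = k"
proof -
  have "concrete_positions \<sigma> = P" using assms(1) by (simp add: star_perms_on_def)
  then show ?thesis using assms(2) card by (auto simp: remove_stars_def)
qed

lemma remove_stars_permutes:
  assumes \<sigma>: "\<sigma> \<in> star_perms_on n P"
  shows "remove_stars \<sigma> permutes {1..n}"
proof (rule bij_imp_permutes)
  note sp = star_perms_onD(1)[OF \<sigma>]
  have inj: "inj_on (remove_stars \<sigma>) {1..n}"
  proof (rule inj_onI)
    fix k l assume kl: "k \<in> {1..n}" "l \<in> {1..n}" "remove_stars \<sigma> k = remove_stars \<sigma> l"
    have "\<sigma> (position k) = enat (remove_stars \<sigma> k)" "\<sigma> (position l) = enat (remove_stars \<sigma> l)"
      using remove_stars_position[OF \<sigma> kl(1)] remove_stars_position[OF \<sigma> kl(2)] by metis+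
    then have "\<sigma> (position k) = \<sigma> (position l)" "\<sigma> (position k) \<noteq> \<infinity>" using kl(3) by simp_all
    then have "position k = position l" by (rule star_perm_inj[OF sp])
    then show "k = l" using inj_onD[OF position_inj] kl by blast
  qed
  have "remove_stars \<sigma> k \<in> {1..n}" if k: "k \<in> {1..n}" for k
  proof -
    have v: "\<sigma> (position k) = enat (remove_stars \<sigma> k)" using remove_stars_position[OF \<sigma> k] by simp
    then show ?thesis using star_perm_bounds[OF sp v] by simp
  qed
  then have "remove_stars \<sigma> ` {1..n} = {1..n}" using endo_inj_surj[OF _ _ inj] by blast
  then show "bij_betw (remove_stars \<sigma>) {1..n} {1..n}" using inj by (simp add: bij_betw_def)
qed (rule remove_stars_outside[OF \<sigma>])

text \<open>
  The symbols of \<open>q\<close> are written into the positions in \<open>P\<close> from left to right.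
\<close>

lemma ex_insert_stars:
  assumes q: "q permutes {1..n}"
  obtains \<rho> where "\<rho> \<in> star_perms_on n P" "remove_stars \<rho> = q"
proof -
  define \<rho> where "\<rho> a = (if a \<in> P then enat (q (inv_into {1..n} position a)) else \<infinity>)" for a
  have \<rho>_pos: "\<rho> (position k) = enat (q k)" if "k \<in> {1..n}" for k
    using that position_image position_inj by (auto simp: \<rho>_def)
  have \<rho>_cases: "a \<notin> P \<or> (\<exists>k\<in>{1..n}. a = position k)" for a using position_image by blast
  have q_in: "q k \<in> {1..n}" if "k \<in> {1..n}" for k using permutes_in_image[OF q] that by blast
  have "\<exists>!a. 1 \<le> a \<and> \<rho> a = enat k" if k: "k \<in> {1..n}" for k
  proof (rule ex1I)
    have l: "inv q k \<in> {1..n}" using permutes_in_image[OF permutes_inv[OF q]] k by blast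
    then have "position (inv q k) \<in> P" using position_image by blast
    then show "1 \<le> position (inv q k) \<and> \<rho> (position (inv q k)) = enat k"
      using \<rho>_pos[OF l] permutes_inverses(1)[OF q] pos by auto
    fix a assume a: "1 \<le> a \<and> \<rho> a = enat k"
    then obtain m where m: "m \<in> {1..n}" "a = position m" using \<rho>_cases[of a] by (auto simp: \<rho>_def)
    then have "q m = k" using \<rho>_pos a by simp
    then show "a = position (inv q k)" using m permutes_inverses(2)[OF q] by auto
  qed
  moreover have "\<rho> a \<in> insert \<infinity> (enat ` {1..n})" for a
  proof (cases "a \<in> P")
    case True
    then obtain k where "k \<in> {1..n}" "a = position k" using \<rho>_cases[of a] by blast
    then show ?thesis using \<rho>_pos q_in by simp
  qed (simp add: \<rho>_def)
  moreover have "0 \<notin> P" using pos by auto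
  then have "\<rho> 0 = \<infinity>" by (simp add: \<rho>_def)
  ultimately have "star_perm n \<rho>" by (simp add: star_perm_def)
  moreover have "concrete_positions \<rho> = P" using pos by (auto simp: concrete_positions_def \<rho>_def)
  ultimately have \<rho>: "\<rho> \<in> star_perms_on n P" by (simp add: star_perms_on_def)
  have "remove_stars \<rho> = q"
  proof
    fix k
    show "remove_stars \<rho> k = q k"
    proof (cases "k \<in> {1..n}")
      case True
      then show ?thesis using remove_stars_position[OF \<rho> True] \<rho>_pos by simp
    next
      case False
      then show ?thesis using remove_stars_outside[OF \<rho>] permutes_not_in[OF q] by simp
    qed
  qed
  then show thesis using that \<rho> by blast
qed

text \<open>
  Removing the stars is an order isomorphism from \<open>P\<close> to \<open>{1..n}\<close>, so it preserves maxima of intervals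
  that contain no star.
\<close>

lemma ancestor_remove_stars:
  assumes \<sigma>: "\<sigma> \<in> star_perms_on n P" and i: "i \<in> {1..n}" and k: "k \<in> {1..n}"
  shows "ancestor \<sigma> (position i) (position k) \<longleftrightarrow>
    {min (position i) (position k)..max (position i) (position k)} \<subseteq> P \<and>
    ancestor (append_stars n (remove_stars \<sigma>)) i k"
proof -
  let ?I = "{min (position i) (position k)..max (position i) (position k)}"
  let ?\<tau> = "append_stars n (remove_stars \<sigma>)"
  have \<tau>: "?\<tau> j = \<sigma> (position j)" if "j \<in> {1..n}" for j
    using remove_stars_position[OF \<sigma> that] that by (simp add: append_stars_def)
  have between: "j \<in> {min i k..max i k} \<longleftrightarrow> position j \<in> ?I" if "j \<in> {1..n}" for j
    using position_le_iff that i k by (auto simp: min_le_iff_disj le_max_iff_disj)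
  have inside: "j \<in> {1..n}" if "j \<in> {min i k..max i k}" for j using that i k by auto
  show ?thesis
  proof
    assume L: "ancestor \<sigma> (position i) (position k)"
    have "c \<in> P" if "c \<in> ?I" for c
      using ancestor_concrete[OF L that] star_perms_onD(2)[OF \<sigma>] by blast
    moreover have "?\<tau> j \<le> ?\<tau> k" if "j \<in> {min i k..max i k}" for j
      using L between[OF inside[OF that]] that \<tau>[OF inside[OF that]] \<tau>[OF k] by (simp add: ancestor_def)
    moreover have "?\<tau> k \<noteq> \<infinity>" using L \<tau>[OF k] by (simp add: ancestor_def)
    ultimately show "?I \<subseteq> P \<and> ancestor ?\<tau> i k" unfolding ancestor_def by blast
  next
    assume R: "?I \<subseteq> P \<and> ancestor ?\<tau> i k"
    have "\<sigma> c \<le> \<sigma> (position k)" if c: "c \<in> ?I" for c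
    proof -
      have "c \<in> P" using R c by blast
      then obtain j where j: "j \<in> {1..n}" "c = position j" using position_image by blast
      then have "?\<tau> j \<le> ?\<tau> k" using R between[OF j(1)] c unfolding ancestor_def by blast
      then show ?thesis using \<tau>[OF j(1)] \<tau>[OF k] j by simp
    qed
    moreover have "\<sigma> (position k) \<noteq> \<infinity>" using R \<tau>[OF k] by (simp add: ancestor_def)
    ultimately show "ancestor \<sigma> (position i) (position k)" unfolding ancestor_def by blast
  qed
qed

text \<open>
  So the Tamari congruence, carried over to the sequences with stars at fixed positions, refines \<open>\<sim>\<close>:
  such a sequence has the ancestors of its permutation, less the pairs with a star in between.
\<close>

lemma ancestor_eq_if_remove_stars:
  assumes \<sigma>: "\<sigma> \<in> star_perms_on n P" and \<rho>: "\<rho> \<in> star_perms_on n P"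
    and eq: "ancestor (append_stars n (remove_stars \<sigma>)) = ancestor (append_stars n (remove_stars \<rho>))"
  shows "ancestor \<sigma> = ancestor \<rho>"
proof (intro ext)
  fix u v
  have inP: "u \<in> P \<and> v \<in> P" if \<tau>: "\<tau> \<in> star_perms_on n P" and anc: "ancestor \<tau> u v" for \<tau>
    using ancestor_concrete[OF anc, of u] ancestor_concrete[OF anc, of v] star_perms_onD(2)[OF \<tau>]
    by (metis atLeastAtMost_iff max.cobounded1 max.cobounded2 min.cobounded1 min.cobounded2)
  show "ancestor \<sigma> u v = ancestor \<rho> u v"
  proof (cases "u \<in> P \<and> v \<in> P")
    case True
    then obtain i k where "i \<in> {1..n}" "u = position i" "k \<in> {1..n}" "v = position k"
      using position_image by blast
    then show ?thesis using ancestor_remove_stars[OF \<sigma>] ancestor_remove_stars[OF \<rho>] eq by simp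
  next
    case False
    then show ?thesis using inP[OF \<sigma>] inP[OF \<rho>] by blast
  qed
qed

lemma union_of_tamari_classes:
  assumes \<sigma>\<^sub>0: "\<sigma>\<^sub>0 \<in> star_perms_on n P"
    and C: "C = {\<rho> \<in> star_perms_on n P. ancestor \<rho> = ancestor \<sigma>\<^sub>0}"
  shows "\<exists>T \<subseteq> tamari_classes n. T \<noteq> {} \<and> remove_stars ` C = \<Union>T"
proof -
  let ?R = "{(p, q). p permutes {1..n} \<and> q permutes {1..n} \<and> append_stars n p \<sim> append_stars n q}"
  let ?T = "(\<lambda>\<sigma>. ?R `` {remove_stars \<sigma>}) ` C"
  have R: "(p, q) \<in> ?R \<longleftrightarrow> p permutes {1..n} \<and> q permutes {1..n} \<and>
      ancestor (append_stars n p) = ancestor (append_stars n q)" for p q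
    using forest_equiv_iff[OF star_perm_append_stars star_perm_append_stars] by blast
  have "?T \<subseteq> tamari_classes n"
  proof
    fix K assume "K \<in> ?T"
    then obtain \<sigma> where "\<sigma> \<in> C" "K = ?R `` {remove_stars \<sigma>}" by blast
    moreover from this have "remove_stars \<sigma> \<in> {p. p permutes {1..n}}"
      using remove_stars_permutes C by blast
    ultimately show "K \<in> tamari_classes n" unfolding tamari_classes_def by (simp only: quotientI)
  qed
  moreover have "?T \<noteq> {}" using \<sigma>\<^sub>0 C by blast
  moreover have "remove_stars ` C = \<Union>?T"
  proof (intro set_eqI iffI)
    fix p assume "p \<in> remove_stars ` C"
    then obtain \<sigma> where \<sigma>: "\<sigma> \<in> C" "p = remove_stars \<sigma>" by blast
    then have "(p, p) \<in> ?R" using R remove_stars_permutes C by blast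
    then show "p \<in> \<Union>?T" using \<sigma> by blast
  next
    fix q assume "q \<in> \<Union>?T"
    then obtain \<sigma> where \<sigma>: "\<sigma> \<in> C" and "(remove_stars \<sigma>, q) \<in> ?R" by blast
    then have q: "q permutes {1..n}" and
      eq: "ancestor (append_stars n (remove_stars \<sigma>)) = ancestor (append_stars n q)"
      using R by blast+
    obtain \<rho> where \<rho>: "\<rho> \<in> star_perms_on n P" "remove_stars \<rho> = q" by (rule ex_insert_stars[OF q])
    have "ancestor \<sigma> = ancestor \<rho>" using ancestor_eq_if_remove_stars[of \<sigma> \<rho>] \<sigma> \<rho> eq C by simp
    then have "\<rho> \<in> C" using \<sigma> \<rho> C by simp
    then show "q \<in> remove_stars ` C" using \<rho> by blast
  qed
  ultimately show ?thesis by blast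
qed

end

lemma congruence_class_eq:
  assumes "C \<in> congruence_classes n P"
  obtains \<sigma>\<^sub>0 where "\<sigma>\<^sub>0 \<in> star_perms_on n P"
    "C = {\<rho> \<in> star_perms_on n P. ancestor \<rho> = ancestor \<sigma>\<^sub>0}"
proof -
  let ?S = "star_perms_on n P"
  obtain \<sigma>\<^sub>0 where C: "C = {(\<rho>, \<sigma>). \<rho> \<in> ?S \<and> \<sigma> \<in> ?S \<and> \<rho> \<sim> \<sigma>} `` {\<sigma>\<^sub>0}" and \<sigma>\<^sub>0: "\<sigma>\<^sub>0 \<in> ?S"
    using assms unfolding congruence_classes_def by (rule quotientE)
  have "\<sigma>\<^sub>0 \<sim> \<rho> \<longleftrightarrow> ancestor \<rho> = ancestor \<sigma>\<^sub>0" if "\<rho> \<in> ?S" for \<rho>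
    unfolding forest_equiv_iff[OF star_perms_onD(1)[OF \<sigma>\<^sub>0] star_perms_onD(1)[OF that]] by (rule eq_commute)
  then have "C = {\<rho> \<in> ?S. ancestor \<rho> = ancestor \<sigma>\<^sub>0}" using \<sigma>\<^sub>0 unfolding C by blast
  then show thesis using that \<sigma>\<^sub>0 by blast
qed

theorem corollary1:
  fixes n :: nat and P :: "nat set" and C :: "star_seq set"
  assumes "finite P" and "P \<subseteq> {1..}" and "card P = n"
    and "C \<in> congruence_classes n P"
  shows "(\<exists>lo \<in> star_perms_on n P. \<exists>hi \<in> star_perms_on n P.
            weak_le n P lo hi \<and> C = weak_interval n P lo hi \<and>
            avoids_132 (Max P) hi \<and> avoids_231 (Max P) lo)
       \<and> (\<exists>T \<subseteq> tamari_classes n. T \<noteq> {} \<and> remove_stars ` C = \<Union>T)"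
proof
  obtain \<sigma>\<^sub>0 where \<sigma>\<^sub>0: "\<sigma>\<^sub>0 \<in> star_perms_on n P"
    and C: "C = {\<rho> \<in> star_perms_on n P. ancestor \<rho> = ancestor \<sigma>\<^sub>0}"
    by (rule congruence_class_eq[OF assms(4)])
  show "\<exists>T \<subseteq> tamari_classes n. T \<noteq> {} \<and> remove_stars ` C = \<Union>T"
    by (rule union_of_tamari_classes[OF assms(1-3) \<sigma>\<^sub>0 C])
  obtain hi where hi: "hi \<in> star_perms_on n P" "ancestor hi = ancestor \<sigma>\<^sub>0"
    and hi_av: "\<not> contains_132 hi"
    by (rule class_element_without_132[OF assms(1) \<sigma>\<^sub>0])
  obtain lo where lo: "lo \<in> star_perms_on n P" "ancestor lo = ancestor \<sigma>\<^sub>0"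
    and lo_av: "\<not> contains_231 lo"
    by (rule class_element_without_231[OF assms(1) \<sigma>\<^sub>0])
  have eq: "ancestor lo = ancestor hi" using lo hi by simp
  have interval: "C = weak_interval n P lo hi"
    using class_is_weak_interval[OF assms(1) lo(1) lo_av hi(1) hi_av eq] C hi(2) by simp
  have "lo \<in> C" using lo C by simp
  then have "weak_le n P lo hi" using interval by (simp add: weak_interval_def)
  moreover have "avoids_132 (Max P) hi" using hi_av unfolding avoids_132_def contains_132_def by blast
  moreover have "avoids_231 (Max P) lo" using lo_av unfolding avoids_231_def contains_231_def by blast
  ultimately show "\<exists>lo \<in> star_perms_on n P. \<exists>hi \<in> star_perms_on n P.
            weak_le n P lo hi \<and> C = weak_interval n P lo hi \<and>
            avoids_132 (Max P) hi \<and> avoids_231 (Max P) lo"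
    using lo(1) hi(1) interval by blast
qed

end
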